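(* Let $h\ge 1$ and let $K, K'\in\mathbb{TM}_{2h}$ be two closed oriented triangulated manifolds of dimension $2h$. If $K'$ is obtained from $K$ by a finite sequence of bistellar $h$-moves, then the bistellar cluster algebras are isomorphic: $\mathcal{A}_{K}\cong\mathcal{A}_{K'}$ (as $\mathbb{ZP}$-algebras).
   Context: **Triangulated manifolds.** $n=2h$. $\mathbb{TM}_n$ is the set of closed oriented triangulated manifolds of dimension $n$, i.e. finite abstract simplicial complexes $K$ on a vertex set $[m]=\{1,\dots,m\}$ whose geometric realization is a closed oriented topological $n$-manifold; the $n$-simplices are oriented so that their sum is a cycle, and every lower-dimensional simplex carries the canonical orientation given by increasing order of its vertices. $\mathcal{F}_i^K$ is the set of $i$-simplices and $\mathcal{F}(K)=\mathcal{F}^K_{n-1}$. Simplices of equal dimension are compared by the lexicographic order $<$ of their increasingly listed vertices. **Bistellar $h$-moves.** A bistellar pair (of type $h$) in $K$ is a pair $(\alpha,\beta)$ with $\alpha\in K$ an $h$-simplex, $\mathrm{Link}_K\alpha=\partial\beta$, $\beta\notin K$, $\dim\beta=h$. The bistellar $h$-move at $\alpha$ is $\mathbf{bm}_\alpha K=(K\setminus(\alpha*\partial\beta))\cup(\partial\alpha*\beta)$. Put $L=\mathbf{bm}_\alpha K$; then $(\beta,\alpha)$ is a bistellar pair in $L$ and $\mathbf{bm}_\beta L=K$. The $n$-simplices common to $K$ and $L$ have the same orientation in both; writing $\alpha=(v_0,\dots,v_h)$, $\beta=(v_{h+1},\dots,v_{n+1})$ with $(v_0,\dots,v_n)$ positively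 oriented in $K$, the new $n$-simplices are oriented as $(-1)^i(v_0,\dots,\widehat{v_i},\dots,v_{n+1})$, $0\le i\le h$. Let $\Lambda_\alpha=\alpha*\partial\beta$, $\Lambda_\beta=\partial\alpha*\beta$, $\mathcal{D}_\alpha=\mathcal{F}(\Lambda_\alpha)\setminus\mathcal{F}(\Lambda_\beta)$, $\mathcal{D}_\beta=\mathcal{F}(\Lambda_\beta)\setminus\mathcal{F}(\Lambda_\alpha)$ (where $\mathcal F(\cdot)$ denotes the $(n-1)$-simplices). Let $\sigma$ be the involution $v_i\mapsto v_{n+1-i}$ of the vertices of $\alpha\cup\beta$; it induces bijections $\mathcal F(\Lambda_\alpha)\to\mathcal F(\Lambda_\beta)$, $\mathcal D_\alpha\to\mathcal D_\beta$ and preserves $\mathcal F(\Lambda_\alpha)\setminus\mathcal D_\alpha=\mathcal F(\Lambda_\beta)\setminus\mathcal D_\beta$. The same involution is used for the inverse move at $\beta$. **Exchange matrix.** For an oriented simplex, $\partial^{(k)}(a_0,\dots,a_n)=\sum_{i_1<\dots<i_k}(-1)^{i_1+\dots+i_k}(\dots,\widehat{a_{i_1}},\dots,\widehat{a_{i_k}},\dots)$, and $\partial^{(k)}(-F)=-\partial^{(k)}F$. For an oriented $n$-simplex $F$ and $(n-1)$-faces $f<g$ of $F$, let $c_{fg}=\pm1$ be the coefficient in $\partial^{(n-1)}F$ of the canonically oriented edge $(f\cup g)\setminus(f\cap g)$; set $b^F_{fg}=c_{fg}$, $b^F_{gf}=-c_{fg}$, and $b^F_{fg}=0$ if $f=g$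 or $f,g$ are not both faces of $F$. $B(K)=(b^K_{fg})_{f,g\in\mathcal F(K)}$ with $b^K_{fg}=\sum_{F\in\mathcal F_n^K}b^F_{fg}$. **Seeds and seed mutation.** Let $(\mathbb P,\oplus,\cdot)$ be a semifield and $\mathbb{ZP}$ the integral group ring of $(\mathbb P,\cdot)$. $\mathcal X(K)=\{x_f\mid f\in\mathcal F(K)\}$ is a set of independent variables (cluster) and $\mathbb F\mathcal X(K)$ is the field of rational functions over $\mathbb{ZP}$ in them. A seed is $\Sigma_K=(\mathcal X(K),\mathbf p_K,B(K))$ with $\mathbf p_K=(p^{\pm}_{K,x})_{x\in\mathcal X(K)}$ in $\mathbb P$, $p^+_{K,x}\oplus p^-_{K,x}=1$. Put $u^K_f=p^+_{K,x_f}/p^-_{K,x_f}$, $[b]_+=\max\{b,0\}$, $\pi^K_{\alpha,f}=\prod_{g\in\mathcal D_\alpha}(p^+_{K,x_g})^{[b^K_{gf}]_+}(p^-_{K,x_g})^{-[-b^K_{gf}]_+}$. The bistellar seed mutation $\Phi_\alpha:\Sigma_K\to\Sigma_L$ replaces $\mathcal X(K)$ by $\mathcal X(L)$, $B(K)$ by $B(L)$, and $\mathbf p_K$ by the normalized tuple $\mathbf p_L$ with $u^L_f=(u^K_{\sigma(f)})^{-1}$ if $f\in\mathcal D_\beta$, $u^L_f=\pi^K_{\alpha,\sigma(f)}u^K_{\sigma(f)}$ if $f\in\mathcal F(\Lambda_\beta)\setminus\mathcal D_\beta$, and $u^L_f=u^K_f$ otherwise; it comes with the exchange relations $x_fx_{\sigma(f)}=M^+_{K,\alpha,f}+M^-_{K,\alpha,f}$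 for $f\in\mathcal D_\alpha$, where $$M^{\pm}_{K,\alpha,f}=\frac{p^{\pm}_{K,x_f}}{D^K_{\alpha,f}}\operatorname{lcm}\Big(\prod_{g}x_g^{[\pm b^K_{fg}]_+},\ \prod_{g}x_{\sigma(g)}^{[\pm b^K_{fg}]_+}\Big),\qquad D^K_{\alpha,f}=\prod_{g:\ b^K_{fg}>0,\ b^K_{f\sigma(g)}<0}x_g^{b^K_{fg}}x_{\sigma(g)}^{b^K_{fg}},$$ all products over $g\in\mathcal F(\Lambda_\alpha)\setminus\mathcal D_\alpha$. **The algebras.** $[K]$ is the (finite) set of all manifolds obtained from $K$ by finite (possibly empty) sequences of bistellar $h$-moves. Each $L\in[K]$ carries a seed $\Sigma_L$, and seeds of manifolds related by a bistellar $h$-move are related by the corresponding bistellar seed mutation. If $L'=\mathbf{bm}_\alpha L$, the fields $\mathbb F\mathcal X(L)$ and $\mathbb F\mathcal X(L')$ are identified through the exchange relations: variables common to both clusters are identified, and $x_{\sigma(f)}$ is identified with $(M^+_{L,\alpha,f}+M^-_{L,\alpha,f})/x_f$ for $f\in\mathcal D_\alpha$. Since any two members of $[K]$ are connected by $h$-moves, all these fields are regarded as a single field $\mathbb F$ containing $\mathcal X_{[K]}=\bigcup_{L\in[K]}\mathcal X(L)$, in which all exchange relations hold. The bistellar cluster algebra $\mathcal A_{[K]}$ is the $\mathbb{ZP}$-subalgebra of $\mathbb F$ generated by $\mathcal X_{[K]}$ (with these exchange relations). For $L\in[K]$, $\mathcal A_L$ is this algebra regarded as a subalgebra of $\mathbb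 F\mathcal X(L)$, all elements being expressed in the variables $\mathcal X(L)$ via the exchange relations, with $\Sigma_L$ as initial seed. If $[K]=\{K\}$, $\mathcal A_K$ is the polynomial ring over $\mathbb{ZP}$ in $\mathcal X(K)$. *)

theory Defs
  imports
    "HOL-Analysis.Analysis"
    "HOL-Library.Poly_Mapping"
    "HOL-Library.List_Lexorder"
    "HOL-Computational_Algebra.Fraction_Field"
begin

section \<open>Oriented triangulated manifolds\<close>

type_synonym face = "nat set"

text \<open>Simplices are nonempty; the empty simplex is never a member of a complex.\<close>

definition simplicial_complex :: "face set \<Rightarrow> bool" where
  "simplicial_complex K \<longleftrightarrow>
     finite K \<and> (\<forall>s\<in>K. finite s \<and> s \<noteq> {}) \<and>
     (\<forall>s\<in>K. \<forall>t. t \<subseteq> s \<and> t \<noteq> {} \<longrightarrow> t \<in> K) \<and>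
     (\<exists>m\<ge>1. \<Union>K = {1..m})"

definition simplices :: "nat \<Rightarrow> face set \<Rightarrow> face set" where
  "simplices i K = {s \<in> K. card s = i + 1}"

text \<open>Points of the geometric realization are given by their barycentric coordinates.\<close>

definition geometric_realization :: "face set \<Rightarrow> (nat \<Rightarrow> real) topology" where
  "geometric_realization K = subtopology (powertop_real UNIV)
     {t. (\<forall>v. 0 \<le> t v) \<and> {v. t v \<noteq> 0} \<in> K \<and> (\<Sum>v\<in>{v. t v \<noteq> 0}. t v) = 1}"

definition closed_topological_manifold :: "nat \<Rightarrow> 'a topology \<Rightarrow> bool" where
  "closed_topological_manifold n X \<longleftrightarrow>
     compact_space X \<and> Hausdorff_space X \<and> second_countable X \<and>
     (\<forall>x\<in>topspace X. \<exists>U V. openin X U \<and> x \<in> U \<and> openin (Euclidean_space n) V \<and>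
        subtopology X U homeomorphic_space subtopology (Euclidean_space n) V)"

definition vertex_index :: "face \<Rightarrow> nat \<Rightarrow> nat" where
  "vertex_index F v = card {u\<in>F. u < v}"

text \<open>The coefficient of the increasingly ordered simplex \<open>e\<close> in the \<open>k\<close>-fold boundary
  \<open>\<partial>\<^sup>(\<^sup>k\<^sup>)(a\<^sub>0, \<dots>, a\<^sub>n)\<close>, where \<open>F = {a\<^sub>0 < \<dots> < a\<^sub>n}\<close>.  For \<open>k \<ge> 2\<close> this expression is not
  invariant under even permutations of the vertices, so an oriented simplex is always
  written as a sign times its increasingly ordered vertices.\<close>

definition boundary_coeff :: "nat \<Rightarrow> face \<Rightarrow> face \<Rightarrow> int" where
  "boundary_coeff k F e =
     (if e \<subseteq> F \<and> card (F - e) = k then (-1) ^ (\<Sum>v\<in>F - e. vertex_index F v) else 0)"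

text \<open>An oriented complex \<open>(K, \<epsilon>)\<close>: for an \<open>n\<close>-simplex \<open>F\<close> of \<open>K\<close> the sign \<open>\<epsilon> F\<close> compares the
  chosen orientation with the one given by increasing order; \<open>\<epsilon>\<close> is \<open>0\<close> elsewhere, so that
  equality of pairs is equality of oriented complexes.\<close>

type_synonym oriented_complex = "face set \<times> (face \<Rightarrow> int)"

definition triangulated_manifolds :: "nat \<Rightarrow> oriented_complex set" where
  "triangulated_manifolds n = {(K, \<epsilon>).
     simplicial_complex K \<and>
     closed_topological_manifold n (geometric_realization K) \<and>
     (\<forall>F\<in>simplices n K. \<epsilon> F = 1 \<or> \<epsilon> F = -1) \<and>
     (\<forall>F. F \<notin> simplices n K \<longrightarrow> \<epsilon> F = 0) \<and>
     (\<forall>f\<in>simplices (n - 1) K. (\<Sum>F\<in>simplices n K. \<epsilon> F * boundary_coeff 1 F f) = 0)}"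

section \<open>Bistellar moves\<close>

definition link :: "face set \<Rightarrow> face \<Rightarrow> face set" where
  "link K s = {t. t \<noteq> {} \<and> t \<inter> s = {} \<and> t \<union> s \<in> K}"

definition simplex_boundary :: "face \<Rightarrow> face set" where
  "simplex_boundary s = {t. t \<noteq> {} \<and> t \<subset> s}"

text \<open>\<open>\<Lambda>\<^sub>\<alpha> = \<alpha> * \<partial>\<beta>\<close> is \<open>join_boundary \<alpha> \<beta>\<close>, and \<open>\<Lambda>\<^sub>\<beta> = \<partial>\<alpha> * \<beta>\<close> is \<open>join_boundary \<beta> \<alpha>\<close>.\<close>

definition join_boundary :: "face \<Rightarrow> face \<Rightarrow> face set" where
  "join_boundary \<alpha> \<beta> = {a \<union> b | a b. a \<subseteq> \<alpha> \<and> b \<subset> \<beta> \<and> a \<union> b \<noteq> {}}"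

definition bistellar_pair :: "nat \<Rightarrow> face set \<Rightarrow> face \<Rightarrow> face \<Rightarrow> bool" where
  "bistellar_pair h K \<alpha> \<beta> \<longleftrightarrow>
     \<alpha> \<in> simplices h K \<and> card \<beta> = h + 1 \<and> \<beta> \<notin> K \<and> link K \<alpha> = simplex_boundary \<beta>"

text \<open>The sign of a list of distinct vertices relative to increasing order.\<close>

definition list_sign :: "nat list \<Rightarrow> int" where
  "list_sign vs = (-1) ^ card {(i, j). i < j \<and> j < length vs \<and> vs ! j < vs ! i}"

text \<open>\<open>vs = [v\<^sub>0, \<dots>, v\<^sub>n\<^sub>+\<^sub>1]\<close> (with \<open>n = 2h\<close>) lists \<open>\<alpha>\<close>, then \<open>\<beta>\<close>, and \<open>(v\<^sub>0, \<dots>, v\<^sub>n)\<close> is positively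
  oriented.\<close>

definition positive_listing ::
  "nat \<Rightarrow> oriented_complex \<Rightarrow> face \<Rightarrow> face \<Rightarrow> nat list \<Rightarrow> bool" where
  "positive_listing h L \<alpha> \<beta> vs \<longleftrightarrow>
     distinct vs \<and> length vs = 2 * h + 2 \<and>
     set (take (h + 1) vs) = \<alpha> \<and> set (drop (h + 1) vs) = \<beta> \<and>
     snd L (set (take (2 * h + 1) vs)) = list_sign (take (2 * h + 1) vs)"

text \<open>\<open>bistellar_move h L \<alpha> \<beta> L'\<close>: the complex \<open>L'\<close> is \<open>bm\<^sub>\<alpha> L\<close> as an oriented complex.\<close>

definition bistellar_move ::
  "nat \<Rightarrow> oriented_complex \<Rightarrow> face \<Rightarrow> face \<Rightarrow> oriented_complex \<Rightarrow> bool" where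
  "bistellar_move h L \<alpha> \<beta> L' \<longleftrightarrow>
     bistellar_pair h (fst L) \<alpha> \<beta> \<and>
     fst L' = (fst L - join_boundary \<alpha> \<beta>) \<union> join_boundary \<beta> \<alpha> \<and>
     (\<forall>F\<in>simplices (2 * h) (fst L) \<inter> simplices (2 * h) (fst L'). snd L' F = snd L F) \<and>
     (\<forall>F. F \<notin> simplices (2 * h) (fst L') \<longrightarrow> snd L' F = 0) \<and>
     (\<exists>vs. positive_listing h L \<alpha> \<beta> vs \<and>
        (\<forall>i\<le>h. snd L' (set vs - {vs ! i}) =
           (-1) ^ i * list_sign (take i vs @ drop (i + 1) vs)))"

text \<open>The set \<open>[K]\<close>.\<close>

definition bistellar_class :: "nat \<Rightarrow> oriented_complex \<Rightarrow> oriented_complex set" where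
  "bistellar_class h K = {L. (\<lambda>T T'. \<exists>\<alpha> \<beta>. bistellar_move h T \<alpha> \<beta> T')\<^sup>*\<^sup>* K L}"

text \<open>\<open>\<F>(L)\<close>, \<open>\<F>(\<Lambda>\<^sub>\<alpha>)\<close> and \<open>\<D>\<^sub>\<alpha>\<close>; exchanging \<open>\<alpha>\<close> and \<open>\<beta>\<close> gives \<open>\<F>(\<Lambda>\<^sub>\<beta>)\<close> and \<open>\<D>\<^sub>\<beta>\<close>.\<close>

definition facets :: "nat \<Rightarrow> oriented_complex \<Rightarrow> face set" where
  "facets h L = simplices (2 * h - 1) (fst L)"

definition facets_join :: "nat \<Rightarrow> face \<Rightarrow> face \<Rightarrow> face set" where
  "facets_join h \<alpha> \<beta> = simplices (2 * h - 1) (join_boundary \<alpha> \<beta>)"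

definition exchanged_facets :: "nat \<Rightarrow> face \<Rightarrow> face \<Rightarrow> face set" where
  "exchanged_facets h \<alpha> \<beta> = facets_join h \<alpha> \<beta> - facets_join h \<beta> \<alpha>"

text \<open>The involution \<open>\<sigma>\<close> depends on the listing \<open>v\<^sub>0, \<dots>, v\<^sub>n\<^sub>+\<^sub>1\<close>.  A choice of involutions assigns one to
  each move from a member of \<open>[K]\<close>, the same one to a move and its inverse.  For odd \<open>h\<close> one
  involution cannot come from positive listings for both a move and its inverse, hence the
  disjunction: the listing belongs to one of the two, and the other uses the same involution.\<close>

type_synonym involutions = "oriented_complex \<Rightarrow> face \<Rightarrow> nat \<Rightarrow> nat"

definition involution_choice :: "nat \<Rightarrow> oriented_complex \<Rightarrow> involutions \<Rightarrow> bool" where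
  "involution_choice h K \<sigma> \<longleftrightarrow>
     (\<forall>L\<in>bistellar_class h K. \<forall>\<alpha> \<beta> L'. bistellar_move h L \<alpha> \<beta> L' \<longrightarrow>
        (\<forall>v\<in>\<alpha> \<union> \<beta>. \<sigma> L' \<beta> v = \<sigma> L \<alpha> v) \<and>
        (\<exists>vs. (positive_listing h L \<alpha> \<beta> vs \<or> positive_listing h L' \<beta> \<alpha> vs) \<and>
           (\<forall>i<2 * h + 2. \<sigma> L \<alpha> (vs ! i) = vs ! (2 * h + 1 - i))))"

section \<open>The exchange matrix\<close>

definition lex_less :: "face \<Rightarrow> face \<Rightarrow> bool" where
  "lex_less f g \<longleftrightarrow> sorted_list_of_set f < sorted_list_of_set g"

definition local_exchange :: "nat \<Rightarrow> oriented_complex \<Rightarrow> face \<Rightarrow> face \<Rightarrow> face \<Rightarrow> int" where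
  "local_exchange h L F f g =
     (let c = snd L F * boundary_coeff (2 * h - 1) F ((f \<union> g) - (f \<inter> g)) in
      if f \<subseteq> F \<and> g \<subseteq> F \<and> f \<noteq> g then (if lex_less f g then c else - c) else 0)"

definition exchange_matrix :: "nat \<Rightarrow> oriented_complex \<Rightarrow> face \<Rightarrow> face \<Rightarrow> int" where
  "exchange_matrix h L f g = (\<Sum>F\<in>simplices (2 * h) (fst L). local_exchange h L F f g)"

section \<open>Semifields and rational functions over the integral group ring\<close>

class semifield = comm_monoid_mult + inverse +
  fixes semifield_add :: "'a \<Rightarrow> 'a \<Rightarrow> 'a"  (infixl "\<oplus>" 65)
  assumes semifield_left_inverse: "inverse a * a = 1"
    and semifield_divide: "a / b = a * inverse b"
    and semifield_add_assoc: "(a \<oplus> b) \<oplus> c = a \<oplus> (b \<oplus> c)"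
    and semifield_add_commute: "a \<oplus> b = b \<oplus> a"
    and semifield_distrib: "a * (b \<oplus> c) = a * b \<oplus> a * c"
begin

lemma semifield_right_inverse: "a * inverse a = 1"
  using semifield_left_inverse by (simp add: mult.commute)

lemma semifield_cancel: "a * c = b * c \<Longrightarrow> a = b"
  by (metis mult.assoc mult.right_neutral semifield_right_inverse)

lemma semifield_torsion_free:
  assumes "x ^ n = 1" "n > 0"
  shows "x = 1"
proof (cases "n = 1")
  case True
  with assms show ?thesis by simp
next
  case False
  have *: "\<exists>t. x * (1 \<oplus> t) = t \<oplus> x ^ (k + 2)" for k
  proof (induction k)
    case 0
    show ?case by (rule exI[of _ x]) (simp add: semifield_distrib power2_eq_square)
  next
    case (Suc k)
    then obtain t where t: "x * (1 \<oplus> t) = t \<oplus> x ^ (k + 2)" by blast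
    have "x * (1 \<oplus> (t \<oplus> x ^ (k + 2))) = x * (1 \<oplus> t) \<oplus> x ^ (Suc k + 2)"
      by (simp add: semifield_add_assoc [symmetric] semifield_distrib)
    then show ?case unfolding t by blast
  qed
  have "n = (n - 2) + 2" using assms(2) False by linarith
  then obtain t where "x * (1 \<oplus> t) = t \<oplus> 1"
    using * [of "n - 2"] assms(1) by metis
  then have "x * (1 \<oplus> t) = 1 * (1 \<oplus> t)"
    by (simp add: semifield_add_commute)
  then show ?thesis by (rule semifield_cancel)
qed

end

text \<open>The multiplicative group of a semifield, written additively, so that
  \<open>\<int>\<bbbP>\<close> is an instance of the monoid algebras of \<open>Poly_Mapping\<close>.\<close>

typedef 'p additive = "UNIV :: 'p set"
  morphisms of_additive to_additive ..

setup_lifting type_definition_additive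

instantiation additive :: (semifield) ab_group_add
begin

lift_definition zero_additive :: "'a additive" is 1 .
lift_definition plus_additive :: "'a additive \<Rightarrow> 'a additive \<Rightarrow> 'a additive" is "(*)" .
lift_definition uminus_additive :: "'a additive \<Rightarrow> 'a additive" is inverse .
lift_definition minus_additive :: "'a additive \<Rightarrow> 'a additive \<Rightarrow> 'a additive"
  is "\<lambda>a b. a * inverse b" .

instance
proof
  fix a b c :: "'a additive"
  show "a + b + c = a + (b + c)" by transfer (rule mult.assoc)
  show "a + b = b + a" by transfer (rule mult.commute)
  show "0 + a = a" by transfer (rule mult_1_left)
  show "- a + a = 0" by transfer (rule semifield_left_inverse)
  show "a - b = a + - b" by transfer (rule HOL.refl)
qed

end

definition nat_multiple :: "nat \<Rightarrow> 'a::monoid_add \<Rightarrow> 'a" where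
  "nat_multiple n x = ((+) x ^^ n) 0"

lemma nat_multiple_0 [simp]: "nat_multiple 0 x = 0"
  by (simp add: nat_multiple_def)

lemma nat_multiple_Suc [simp]: "nat_multiple (Suc n) x = x + nat_multiple n x"
  by (simp add: nat_multiple_def)

lemma nat_multiple_add: "nat_multiple (m + n) x = nat_multiple m x + nat_multiple n x"
  by (induction m) (auto simp: add.assoc)

lemma nat_multiple_mult: "nat_multiple (m * n) x = nat_multiple m (nat_multiple n x)"
  by (induction m) (auto simp: nat_multiple_add)

lemma nat_multiple_minus: "nat_multiple n (- x) = - nat_multiple n (x :: 'a::ab_group_add)"
  by (induction n) simp_all

lemma additive_torsion_free:
  assumes "nat_multiple n (x :: 'a::semifield additive) = 0" "n > 0"
  shows "x = 0"
proof -
  have "of_additive (nat_multiple n x) = of_additive x ^ n"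
    by (induction n) (auto simp: zero_additive.rep_eq plus_additive.rep_eq)
  then have "of_additive x = 1"
    using assms by (metis semifield_torsion_free zero_additive.rep_eq)
  then show ?thesis by (metis of_additive_inject zero_additive.rep_eq)
qed

text \<open>A torsion-free abelian group carries a compatible linear order; an arbitrary one is chosen.
  It only serves to make \<open>\<int>\<bbbP>\<close> an integral domain, so that fractions can be formed.\<close>

definition positive_cone :: "'a::ab_group_add set \<Rightarrow> bool" where
  "positive_cone C \<longleftrightarrow> 0 \<in> C \<and> (\<forall>x\<in>C. \<forall>y\<in>C. x + y \<in> C) \<and> (\<forall>x. x \<in> C \<and> - x \<in> C \<longrightarrow> x = 0)"

lemma positive_cone_multiple: "positive_cone C \<Longrightarrow> x \<in> C \<Longrightarrow> nat_multiple n x \<in> C"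
  by (induction n) (auto simp: positive_cone_def)

lemma maximal_cone_step:
  fixes g :: "'a::ab_group_add"
  assumes C: "positive_cone C" and max: "\<And>D. positive_cone D \<Longrightarrow> C \<subseteq> D \<Longrightarrow> D = C"
    and g: "g \<notin> C"
  shows "\<exists>k>0. - nat_multiple k g \<in> C"
proof -
  define D where "D = {c + nat_multiple n g | c n. c \<in> C}"
  have "C \<subseteq> D"
  proof
    fix c assume "c \<in> C"
    moreover have "c = c + nat_multiple 0 g" by simp
    ultimately show "c \<in> D" unfolding D_def by blast
  qed
  have "0 \<in> C" using C by (simp add: positive_cone_def)
  then have "0 + nat_multiple 1 g \<in> D" unfolding D_def by blast
  then have "D \<noteq> C" using g by auto
  then have "\<not> positive_cone D" using max \<open>C \<subseteq> D\<close> by blast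
  moreover have "0 \<in> D" using \<open>0 \<in> C\<close> \<open>C \<subseteq> D\<close> by blast
  moreover have "x + y \<in> D" if xy: "x \<in> D" "y \<in> D" for x y
  proof -
    from xy obtain c n d m where "x = c + nat_multiple n g" "y = d + nat_multiple m g"
      and cd: "c \<in> C" "d \<in> C"
      unfolding D_def by blast
    then have "x + y = (c + d) + nat_multiple (n + m) g"
      by (simp add: nat_multiple_add algebra_simps)
    moreover have "c + d \<in> C" using C cd by (simp add: positive_cone_def)
    ultimately show ?thesis unfolding D_def by blast
  qed
  ultimately obtain x where x: "x \<in> D" "- x \<in> D" "x \<noteq> 0"
    unfolding positive_cone_def by blast
  then obtain c n d m where e: "x = c + nat_multiple n g" "- x = d + nat_multiple m g"
    and cd: "c \<in> C" "d \<in> C"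
    unfolding D_def by blast
  have sum: "(c + d) + nat_multiple (n + m) g = 0"
  proof -
    have "(c + d) + nat_multiple (n + m) g = (c + nat_multiple n g) + (d + nat_multiple m g)"
      by (simp add: nat_multiple_add add_ac)
    also have "\<dots> = x + (- x)" by (simp only: e [symmetric])
    finally show ?thesis by simp
  qed
  have "n + m > 0"
  proof (rule ccontr)
    assume "\<not> n + m > 0"
    then have "n = 0" "m = 0" by auto
    then have "x = c" "- x = d" using e by auto
    then show False using C cd x(3) unfolding positive_cone_def by blast
  qed
  moreover have "- nat_multiple (n + m) g = c + d"
    using sum by (metis add.commute minus_unique)
  then have "- nat_multiple (n + m) g \<in> C" using C cd by (simp add: positive_cone_def)
  ultimately show ?thesis by blast
qed

lemma ex_total_cone:
  "\<exists>C :: 'a::semifield additive set. positive_cone C \<and> (\<forall>x. x \<in> C \<or> - x \<in> C)"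
proof -
  define A where "A = {C :: 'a additive set. positive_cone C}"
  have "\<exists>M\<in>A. \<forall>X\<in>A. M \<subseteq> X \<longrightarrow> X = M"
  proof (rule subset_Zorn_nonempty)
    have "{0} \<in> A" by (auto simp: A_def positive_cone_def)
    then show "A \<noteq> {}" by blast
  next
    fix \<C> assume ne: "\<C> \<noteq> {}" and ch: "subset.chain A \<C>"
    have pc: "positive_cone C" if "C \<in> \<C>" for C
      using ch that by (auto simp: subset.chain_def A_def)
    have tot: "C \<subseteq> D \<or> D \<subseteq> C" if "C \<in> \<C>" "D \<in> \<C>" for C D
      using ch that by (auto simp: subset.chain_def)
    have "0 \<in> \<Union>\<C>" using ne pc by (auto simp: positive_cone_def)
    moreover have both: "\<exists>C\<in>\<C>. x \<in> C \<and> y \<in> C" if "x \<in> \<Union>\<C>" "y \<in> \<Union>\<C>" for x y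
      using that tot by blast
    have "x + y \<in> \<Union>\<C>" if "x \<in> \<Union>\<C>" "y \<in> \<Union>\<C>" for x y
      using both [OF that] pc unfolding positive_cone_def by blast
    moreover have "x = 0" if "x \<in> \<Union>\<C>" "- x \<in> \<Union>\<C>" for x
      using both [OF that] pc unfolding positive_cone_def by blast
    ultimately show "\<Union>\<C> \<in> A"
      unfolding A_def positive_cone_def by blast
  qed
  then obtain C :: "'a additive set" where C: "positive_cone C"
    and max: "\<And>D. positive_cone D \<Longrightarrow> C \<subseteq> D \<Longrightarrow> D = C"
    unfolding A_def by blast
  have "x \<in> C \<or> - x \<in> C" for x
  proof (rule ccontr)
    assume "\<not> (x \<in> C \<or> - x \<in> C)"
    then obtain k l where kl: "k > 0" "l > 0" "- nat_multiple k x \<in> C" "- nat_multiple l (- x) \<in> C"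
      using maximal_cone_step [OF C max] by metis
    have "nat_multiple l x \<in> C" using kl(4) by (simp add: nat_multiple_minus)
    then have "nat_multiple k (nat_multiple l x) \<in> C" by (rule positive_cone_multiple [OF C])
    then have 1: "nat_multiple (k * l) x \<in> C" by (simp add: nat_multiple_mult)
    have "nat_multiple l (- nat_multiple k x) \<in> C" by (rule positive_cone_multiple [OF C kl(3)])
    then have "- nat_multiple (k * l) x \<in> C"
      by (simp add: nat_multiple_mult nat_multiple_minus mult.commute [of k])
    then have "nat_multiple (k * l) x = 0" using 1 C by (simp add: positive_cone_def)
    then have "x = 0" using kl(1,2) additive_torsion_free [of "k * l" x] by simp
    then show False using \<open>\<not> (x \<in> C \<or> - x \<in> C)\<close> C by (auto simp: positive_cone_def)
  qed
  with C show ?thesis by blast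
qed

definition total_cone :: "'a::semifield additive set" where
  "total_cone = (SOME C. positive_cone C \<and> (\<forall>x. x \<in> C \<or> - x \<in> C))"

lemma total_cone:
  "positive_cone (total_cone :: 'a::semifield additive set)
   \<and> (\<forall>x::'a additive. x \<in> total_cone \<or> - x \<in> total_cone)"
  unfolding total_cone_def by (rule someI_ex [OF ex_total_cone])

lemma total_cone_rules:
  fixes x y :: "'a::semifield additive"
  shows "0 \<in> (total_cone :: 'a additive set)"
    and "x \<in> total_cone \<Longrightarrow> y \<in> total_cone \<Longrightarrow> x + y \<in> total_cone"
    and "x \<in> total_cone \<Longrightarrow> - x \<in> total_cone \<Longrightarrow> x = 0"
    and "x \<in> total_cone \<or> - x \<in> total_cone"
  using total_cone [where 'a = 'a] unfolding positive_cone_def by blast+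

instantiation additive :: (semifield) linordered_ab_group_add
begin

definition less_eq_additive :: "'a additive \<Rightarrow> 'a additive \<Rightarrow> bool" where
  "less_eq_additive x y \<longleftrightarrow> y - x \<in> total_cone"

definition less_additive :: "'a additive \<Rightarrow> 'a additive \<Rightarrow> bool" where
  "less_additive x y \<longleftrightarrow> x \<le> y \<and> \<not> y \<le> x"

instance
proof
  fix x y z :: "'a additive"
  show "x < y \<longleftrightarrow> x \<le> y \<and> \<not> y \<le> x" by (rule less_additive_def)
  show "x \<le> x" by (simp add: less_eq_additive_def total_cone_rules(1))
  show "x \<le> z" if "x \<le> y" "y \<le> z"
    using total_cone_rules(2) [of "y - x" "z - y"] that by (simp add: less_eq_additive_def)
  show "x = y" if "x \<le> y" "y \<le> x"
    using total_cone_rules(3) [of "y - x"] that by (simp add: less_eq_additive_def)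
  show "x \<le> y \<or> y \<le> x"
    using total_cone_rules(4) [of "y - x"] by (simp add: less_eq_additive_def)
  show "z + x \<le> z + y" if "x \<le> y"
    using that by (simp add: less_eq_additive_def)
qed

end

type_synonym 'p group_ring = "'p additive \<Rightarrow>\<^sub>0 int"

text \<open>Monomials in variables indexed by increasingly listed simplices, and the field of rational
  functions over \<open>\<int>\<bbbP>\<close> in these variables.  The fields \<open>\<bbbF>\<X>(L)\<close> are subfields of it.\<close>

type_synonym monomial = "nat list \<Rightarrow>\<^sub>0 nat"
type_synonym 'p ratfun = "(monomial \<Rightarrow>\<^sub>0 'p group_ring) fract"

definition scalar :: "'p::semifield group_ring \<Rightarrow> 'p ratfun" where
  "scalar c = Fract (Poly_Mapping.single 0 c) 1"

definition semifield_scalar :: "'p::semifield \<Rightarrow> 'p ratfun" where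
  "semifield_scalar p = scalar (Poly_Mapping.single (to_additive p) 1)"

definition var_monomial :: "face \<Rightarrow> nat \<Rightarrow> monomial" where
  "var_monomial f e = Poly_Mapping.single (sorted_list_of_set f) e"

definition of_monomial :: "monomial \<Rightarrow> 'p::semifield ratfun" where
  "of_monomial m = Fract (Poly_Mapping.single m 1) 1"

definition var :: "face \<Rightarrow> 'p::semifield ratfun" where
  "var f = of_monomial (var_monomial f 1)"

lift_definition lcm_monomial :: "monomial \<Rightarrow> monomial \<Rightarrow> monomial"
  is "\<lambda>a b v. max (a v) (b v)"
proof -
  fix a b :: "nat list \<Rightarrow> nat"
  assume "finite {v. a v \<noteq> 0}" "finite {v. b v \<noteq> 0}"
  then have "finite ({v. a v \<noteq> 0} \<union> {v. b v \<noteq> 0})" by blast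
  then show "finite {v. max (a v) (b v) \<noteq> 0}"
    by (rule rev_finite_subset) auto
qed

lemma le_monomial_iff: "(\<exists>d. k = a + d) \<longleftrightarrow> (\<forall>v. Poly_Mapping.lookup a v \<le> Poly_Mapping.lookup k v)" for a k :: monomial
proof
  assume le: "\<forall>v. Poly_Mapping.lookup a v \<le> Poly_Mapping.lookup k v"
  have "k = a + (k - a)"
    by (rule poly_mapping_eqI) (simp add: lookup_add lookup_minus le)
  then show "\<exists>d. k = a + d" ..
qed (auto simp: lookup_add)

lemma lcm_monomial_divides_iff:
  "(\<exists>d. k = lcm_monomial a b + d) \<longleftrightarrow> (\<exists>d. k = a + d) \<and> (\<exists>d. k = b + d)"
  by (auto simp: le_monomial_iff lcm_monomial.rep_eq)

text \<open>The subalgebra generated by \<open>S\<close> in an algebra with structure map \<open>\<kappa>\<close>.\<close>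

inductive_set subalgebra_generated :: "('c \<Rightarrow> 'f::comm_ring_1) \<Rightarrow> 'f set \<Rightarrow> 'f set" for \<kappa> S where
  scalar: "\<kappa> c \<in> subalgebra_generated \<kappa> S"
| gen: "x \<in> S \<Longrightarrow> x \<in> subalgebra_generated \<kappa> S"
| add: "x \<in> subalgebra_generated \<kappa> S \<Longrightarrow> y \<in> subalgebra_generated \<kappa> S \<Longrightarrow>
    x + y \<in> subalgebra_generated \<kappa> S"
| mult: "x \<in> subalgebra_generated \<kappa> S \<Longrightarrow> y \<in> subalgebra_generated \<kappa> S \<Longrightarrow>
    x * y \<in> subalgebra_generated \<kappa> S"

definition cluster :: "nat \<Rightarrow> oriented_complex \<Rightarrow> 'p::semifield ratfun set" where
  "cluster h L = var ` facets h L"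

definition cluster_field :: "nat \<Rightarrow> oriented_complex \<Rightarrow> 'p::semifield ratfun set" where
  "cluster_field h L = {a / b | a b.
     a \<in> subalgebra_generated scalar (cluster h L) \<and> b \<in> subalgebra_generated scalar (cluster h L) \<and> b \<noteq> 0}"

section \<open>Seeds and seed mutation\<close>

text \<open>The cluster \<open>\<X>(L)\<close> and the matrix \<open>B(L)\<close> of a seed are determined by \<open>L\<close>, so a family of seeds
  is given by the coefficients \<open>p L f = (p\<^sup>+, p\<^sup>-)\<close> at \<open>x\<^sub>f\<close> in \<open>\<Sigma>\<^sub>L\<close>.\<close>

type_synonym 'p seeds = "oriented_complex \<Rightarrow> face \<Rightarrow> 'p \<times> 'p"

definition coeff_ratio :: "'p::semifield seeds \<Rightarrow> oriented_complex \<Rightarrow> face \<Rightarrow> 'p" where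
  "coeff_ratio p L f = fst (p L f) / snd (p L f)"

definition coeff_product ::
  "nat \<Rightarrow> 'p::semifield seeds \<Rightarrow> oriented_complex \<Rightarrow> face \<Rightarrow> face \<Rightarrow> face \<Rightarrow> 'p" where
  "coeff_product h p L \<alpha> \<beta> f = (\<Prod>g\<in>exchanged_facets h \<alpha> \<beta>.
     fst (p L g) ^ nat (max (exchange_matrix h L g f) 0) *
     inverse (snd (p L g) ^ nat (max (- exchange_matrix h L g f) 0)))"

definition seed_mutation ::
  "nat \<Rightarrow> involutions \<Rightarrow> 'p::semifield seeds \<Rightarrow>
   oriented_complex \<Rightarrow> face \<Rightarrow> face \<Rightarrow> oriented_complex \<Rightarrow> bool" where
  "seed_mutation h \<sigma> p L \<alpha> \<beta> L' \<longleftrightarrow> (\<forall>f\<in>facets h L'.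
     coeff_ratio p L' f =
       (if f \<in> exchanged_facets h \<beta> \<alpha> then inverse (coeff_ratio p L (\<sigma> L \<alpha> ` f))
        else if f \<in> facets_join h \<beta> \<alpha>
          then coeff_product h p L \<alpha> \<beta> (\<sigma> L \<alpha> ` f) * coeff_ratio p L (\<sigma> L \<alpha> ` f)
        else coeff_ratio p L f))"

definition seed_family ::
  "nat \<Rightarrow> oriented_complex \<Rightarrow> involutions \<Rightarrow> 'p::semifield seeds \<Rightarrow> bool" where
  "seed_family h K \<sigma> p \<longleftrightarrow>
     (\<forall>L\<in>bistellar_class h K. \<forall>f\<in>facets h L. fst (p L f) \<oplus> snd (p L f) = 1) \<and>
     (\<forall>L\<in>bistellar_class h K. \<forall>\<alpha> \<beta> L'.
        bistellar_move h L \<alpha> \<beta> L' \<longrightarrow> seed_mutation h \<sigma> p L \<alpha> \<beta> L')"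

definition common_facets :: "nat \<Rightarrow> face \<Rightarrow> face \<Rightarrow> face set" where
  "common_facets h \<alpha> \<beta> = facets_join h \<alpha> \<beta> - exchanged_facets h \<alpha> \<beta>"

text \<open>\<open>exchange_denominator\<close> is \<open>D\<close>; for \<open>q = p\<^sup>\<plusminus>\<close> and \<open>s = \<plusminus>1\<close>, \<open>exchange_term\<close> is \<open>M\<^sup>\<plusminus>\<close>.\<close>

definition exchange_denominator ::
  "nat \<Rightarrow> involutions \<Rightarrow> oriented_complex \<Rightarrow> face \<Rightarrow> face \<Rightarrow> face \<Rightarrow>
   'p::semifield ratfun" where
  "exchange_denominator h \<sigma> L \<alpha> \<beta> f =
     (\<Prod>g\<in>{g\<in>common_facets h \<alpha> \<beta>.
          exchange_matrix h L f g > 0 \<and> exchange_matrix h L f (\<sigma> L \<alpha> ` g) < 0}.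
        var g ^ nat (exchange_matrix h L f g) * var (\<sigma> L \<alpha> ` g) ^ nat (exchange_matrix h L f g))"

definition exchange_term ::
  "nat \<Rightarrow> involutions \<Rightarrow> 'p::semifield \<Rightarrow> int \<Rightarrow> oriented_complex \<Rightarrow> face \<Rightarrow> face \<Rightarrow> face \<Rightarrow>
   'p ratfun" where
  "exchange_term h \<sigma> q s L \<alpha> \<beta> f =
     semifield_scalar q / exchange_denominator h \<sigma> L \<alpha> \<beta> f *
     of_monomial (lcm_monomial
       (\<Sum>g\<in>common_facets h \<alpha> \<beta>. var_monomial g (nat (max (s * exchange_matrix h L f g) 0)))
       (\<Sum>g\<in>common_facets h \<alpha> \<beta>.
          var_monomial (\<sigma> L \<alpha> ` g) (nat (max (s * exchange_matrix h L f g) 0))))"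

definition exchange_rhs ::
  "nat \<Rightarrow> involutions \<Rightarrow> 'p::semifield seeds \<Rightarrow> oriented_complex \<Rightarrow> face \<Rightarrow> face \<Rightarrow> face \<Rightarrow>
   'p ratfun" where
  "exchange_rhs h \<sigma> p L \<alpha> \<beta> f =
     exchange_term h \<sigma> (fst (p L f)) 1 L \<alpha> \<beta> f + exchange_term h \<sigma> (snd (p L f)) (-1) L \<alpha> \<beta> f"

section \<open>Bistellar cluster algebras\<close>

text \<open>Isomorphisms of \<open>\<int>\<bbbP>\<close>-algebras between subalgebras of the field of rational functions.\<close>

definition algebra_isomorphism ::
  "'p::semifield ratfun set \<Rightarrow> 'p ratfun set \<Rightarrow> ('p ratfun \<Rightarrow> 'p ratfun) \<Rightarrow> bool" where
  "algebra_isomorphism A B \<phi> \<longleftrightarrow>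
     bij_betw \<phi> A B \<and>
     (\<forall>x\<in>A. \<forall>y\<in>A. \<phi> (x + y) = \<phi> x + \<phi> y \<and> \<phi> (x * y) = \<phi> x * \<phi> y) \<and>
     (\<forall>c. \<phi> (scalar c) = scalar c)"

definition algebras_isomorphic :: "'p::semifield ratfun set \<Rightarrow> 'p ratfun set \<Rightarrow> bool" where
  "algebras_isomorphic A B \<longleftrightarrow> (\<exists>\<phi>. algebra_isomorphism A B \<phi>)"

text \<open>The identification of \<open>\<bbbF>\<X>(L')\<close> with \<open>\<bbbF>\<X>(L)\<close> through the exchange relations, where
  \<open>L' = bm\<^sub>\<alpha> L\<close>.  On \<open>\<bbbF>\<X>(L')\<close> the map \<open>\<phi>\<close> is determined by these conditions.\<close>

definition exchange_identification ::
  "nat \<Rightarrow> involutions \<Rightarrow> 'p::semifield seeds \<Rightarrow>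
   oriented_complex \<Rightarrow> face \<Rightarrow> face \<Rightarrow> oriented_complex \<Rightarrow> ('p ratfun \<Rightarrow> 'p ratfun) \<Rightarrow> bool" where
  "exchange_identification h \<sigma> p L \<alpha> \<beta> L' \<phi> \<longleftrightarrow>
     bistellar_move h L \<alpha> \<beta> L' \<and>
     algebra_isomorphism (cluster_field h L') (cluster_field h L) \<phi> \<and>
     (\<forall>f\<in>facets h L \<inter> facets h L'. \<phi> (var f) = var f) \<and>
     (\<forall>f\<in>exchanged_facets h \<alpha> \<beta>. \<phi> (var (\<sigma> L \<alpha> ` f)) = exchange_rhs h \<sigma> p L \<alpha> \<beta> f / var f)"

text \<open>\<open>identified h K \<sigma> p L z L' z'\<close>: the elements \<open>z\<close> of \<open>\<bbbF>\<X>(L)\<close> and \<open>z'\<close> of \<open>\<bbbF>\<X>(L')\<close> are equal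
  in the single field \<open>\<bbbF>\<close>, i.e. related by the equivalence relation generated by the
  identifications along the bistellar moves within \<open>[K]\<close>.\<close>

inductive identified ::
  "nat \<Rightarrow> oriented_complex \<Rightarrow> involutions \<Rightarrow> 'p::semifield seeds \<Rightarrow>
   oriented_complex \<Rightarrow> 'p ratfun \<Rightarrow> oriented_complex \<Rightarrow> 'p ratfun \<Rightarrow> bool"
  for h K \<sigma> p where
  refl: "L \<in> bistellar_class h K \<Longrightarrow> z \<in> cluster_field h L \<Longrightarrow> identified h K \<sigma> p L z L z"
| step: "L \<in> bistellar_class h K \<Longrightarrow> exchange_identification h \<sigma> p L \<alpha> \<beta> L' \<phi> \<Longrightarrow>
    z \<in> cluster_field h L' \<Longrightarrow> identified h K \<sigma> p L (\<phi> z) L' z"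
| sym: "identified h K \<sigma> p L z L' z' \<Longrightarrow> identified h K \<sigma> p L' z' L z"
| trans: "identified h K \<sigma> p L z L' z' \<Longrightarrow> identified h K \<sigma> p L' z' L'' z'' \<Longrightarrow>
    identified h K \<sigma> p L z L'' z''"

text \<open>The algebra \<open>\<A>\<^sub>K\<close>: the cluster variables of all members of \<open>[K]\<close> are expressed in the variables
  \<open>\<X>(K)\<close> through the identifications, and generate a subalgebra of \<open>\<bbbF>\<X>(K)\<close>.\<close>

definition bistellar_cluster_algebra ::
  "nat \<Rightarrow> involutions \<Rightarrow> 'p::semifield seeds \<Rightarrow> oriented_complex \<Rightarrow> 'p ratfun set" where
  "bistellar_cluster_algebra h \<sigma> p K = subalgebra_generated scalar
     {z. \<exists>L\<in>bistellar_class h K. \<exists>f\<in>facets h L. identified h K \<sigma> p K z L (var f)}"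

section \<open>The algebra inside a single field\<close>

text \<open>Suppose the fields \<open>\<bbbF>\<X>(L)\<close> can be regarded as a single field \<open>\<bbbF>\<close> (the type \<open>'f\<close>) in which all
  exchange relations hold.  Then \<open>\<A>\<^sub>K\<close> is the subalgebra of \<open>\<bbbF>\<close> generated by all cluster
  variables, expressed in the variables \<open>\<X>(K)\<close>.  The definition of \<open>\<A>\<^sub>K\<close> itself does not
  presuppose that such a field exists, that is, that the identifications along closed
  sequences of moves are trivial.\<close>

definition single_field ::
  "nat \<Rightarrow> oriented_complex \<Rightarrow> involutions \<Rightarrow> 'p::semifield seeds \<Rightarrow> ('p group_ring \<Rightarrow> 'f::field) \<Rightarrow>
   (oriented_complex \<Rightarrow> 'p ratfun \<Rightarrow> 'f) \<Rightarrow> bool" where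
  "single_field h K \<sigma> p \<kappa> \<iota> \<longleftrightarrow>
     (\<forall>L\<in>bistellar_class h K.
        bij_betw (\<iota> L) (cluster_field h L) UNIV \<and>
        (\<forall>x\<in>cluster_field h L. \<forall>y\<in>cluster_field h L.
           \<iota> L (x + y) = \<iota> L x + \<iota> L y \<and> \<iota> L (x * y) = \<iota> L x * \<iota> L y) \<and>
        (\<forall>c. \<iota> L (scalar c) = \<kappa> c)) \<and>
     (\<forall>L\<in>bistellar_class h K. \<forall>\<alpha> \<beta> L'. bistellar_move h L \<alpha> \<beta> L' \<longrightarrow>
        (\<forall>f\<in>facets h L \<inter> facets h L'. \<iota> L' (var f) = \<iota> L (var f)) \<and>
        (\<forall>f\<in>exchanged_facets h \<alpha> \<beta>.
           \<iota> L (var f) * \<iota> L' (var (\<sigma> L \<alpha> ` f)) = \<iota> L (exchange_rhs h \<sigma> p L \<alpha> \<beta> f)))"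

lemma scalar_0 [simp]: "scalar 0 = 0" and scalar_1 [simp]: "scalar 1 = 1"
  by (simp_all add: scalar_def Zero_fract_def One_fract_def)

lemma of_monomial_nonzero [simp]: "(of_monomial m :: 'a::semifield ratfun) \<noteq> 0"
proof -
  have "Poly_Mapping.single m (1 :: 'a group_ring) \<noteq> 0"
    by (metis lookup_single_eq lookup_zero zero_neq_one)
  then show ?thesis by (simp add: of_monomial_def Zero_fract_def eq_fract)
qed

lemma of_monomial_0 [simp]: "of_monomial 0 = 1"
  by (simp add: of_monomial_def One_fract_def)

lemma of_monomial_add: "of_monomial (a + b) = of_monomial a * of_monomial b"
  by (simp add: of_monomial_def mult_single)

lemma var_nonzero [simp]: "var f \<noteq> 0"
  by (simp add: var_def)

lemma of_monomial_var_monomial: "of_monomial (var_monomial f e) = var f ^ e"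
proof (induction e)
  case 0
  then show ?case by (simp add: var_monomial_def)
next
  case (Suc e)
  have "var_monomial f (Suc e) = var_monomial f 1 + var_monomial f e"
    by (simp add: var_monomial_def flip: single_add)
  then show ?case by (simp add: of_monomial_add var_def Suc)
qed

lemma cluster_field_quotient:
  assumes "x \<in> cluster_field h L" "y \<in> cluster_field h L"
  shows "x / y \<in> cluster_field h L" "x * y \<in> cluster_field h L" "x + y \<in> cluster_field h L"
proof -
  let ?A = "subalgebra_generated scalar (cluster h L)"
  obtain a b c d where x: "x = a / b" "a \<in> ?A" "b \<in> ?A" "b \<noteq> 0"
    and y: "y = c / d" "c \<in> ?A" "d \<in> ?A" "d \<noteq> 0"
    using assms unfolding cluster_field_def by auto
  note intros = subalgebra_generated.mult subalgebra_generated.add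
  have I: "u / v \<in> cluster_field h L" if "u \<in> ?A" "v \<in> ?A" "v \<noteq> 0" for u v
    using that unfolding cluster_field_def by blast
  have 0: "0 \<in> ?A" "1 \<in> ?A"
    using subalgebra_generated.scalar [of scalar 0] subalgebra_generated.scalar [of scalar 1] by auto
  show "x * y \<in> cluster_field h L"
    using I [of "a * c" "b * d"] x y by (simp add: intros)
  show "x + y \<in> cluster_field h L"
    using I [of "a * d + c * b" "b * d"] x y by (simp add: intros add_frac_eq)
  show "x / y \<in> cluster_field h L"
  proof (cases "c = 0")
    case True
    then show ?thesis using I [of 0 1] 0 y by simp
  next
    case False
    then show ?thesis using I [of "a * d" "b * c"] x y by (simp add: intros)
  qed
qed

lemma subalgebra_in_cluster_field:
  "subalgebra_generated scalar (cluster h L) \<subseteq> cluster_field h L"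
proof
  fix x :: "'a::semifield ratfun"
  assume "x \<in> subalgebra_generated scalar (cluster h L)"
  moreover have "(1 :: 'a ratfun) \<in> subalgebra_generated scalar (cluster h L)"
    using subalgebra_generated.scalar [of scalar 1] by auto
  ultimately show "x \<in> cluster_field h L"
    unfolding cluster_field_def by (intro CollectI exI [of _ x] exI [of _ 1]) simp
qed

lemma scalar_in_cluster_field: "scalar c \<in> cluster_field h L"
  by (rule subsetD [OF subalgebra_in_cluster_field]) (rule subalgebra_generated.scalar)

lemma var_in_cluster_field: "f \<in> facets h L \<Longrightarrow> var f \<in> cluster_field h L"
  using subalgebra_in_cluster_field subalgebra_generated.gen unfolding cluster_def by blast

lemma one_in_cluster_field: "1 \<in> cluster_field h L"
  using scalar_in_cluster_field [of 1] by simp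

lemma power_in_cluster_field: "x \<in> cluster_field h L \<Longrightarrow> x ^ n \<in> cluster_field h L"
  by (induction n) (simp_all add: one_in_cluster_field cluster_field_quotient)

lemma prod_in_cluster_field:
  "(\<And>i. i \<in> I \<Longrightarrow> x i \<in> cluster_field h L) \<Longrightarrow> prod x I \<in> cluster_field h L"
  by (induction I rule: infinite_finite_induct)
    (simp_all add: one_in_cluster_field cluster_field_quotient)

lemma bij_nth_involution:
  assumes "distinct vs" "length vs = 2 * h + 2"
    and \<sigma>: "\<forall>i<2 * h + 2. s (vs ! i) = vs ! (2 * h + 1 - i)"
    and A: "set (take (h + 1) vs) = A" and B: "set (drop (h + 1) vs) = B"
  shows "\<forall>v\<in>A. s v \<in> B" "\<forall>v\<in>B. s v \<in> A" "\<forall>v\<in>A \<union> B. s (s v) = v" "A \<inter> B = {}"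
proof -
  have A': "A = {vs ! i | i. i < h + 1}"
  proof -
    have "h + 1 \<le> length vs" using assms(2) by simp
    then show ?thesis unfolding A [symmetric] nth_image [symmetric, OF \<open>h + 1 \<le> length vs\<close>] by auto
  qed
  have B': "B = {vs ! i | i. h + 1 \<le> i \<and> i < 2 * h + 2}"
  proof -
    have "v \<in> set (drop (h + 1) vs) \<longleftrightarrow> (\<exists>i. v = vs ! i \<and> h + 1 \<le> i \<and> i < 2 * h + 2)" for v
    proof
      assume "v \<in> set (drop (h + 1) vs)"
      then obtain j where "j < length vs - (h + 1)" "v = vs ! (h + 1 + j)"
        by (auto simp: in_set_conv_nth)
      then show "\<exists>i. v = vs ! i \<and> h + 1 \<le> i \<and> i < 2 * h + 2"
        using assms(2) by (intro exI [of _ "h + 1 + j"]) simp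
    next
      assume "\<exists>i. v = vs ! i \<and> h + 1 \<le> i \<and> i < 2 * h + 2"
      then obtain i where "v = vs ! i" "h + 1 \<le> i" "i < 2 * h + 2" by blast
      then have "drop (h + 1) vs ! (i - (h + 1)) = v" "i - (h + 1) < length (drop (h + 1) vs)"
        using assms(2) by simp_all
      then show "v \<in> set (drop (h + 1) vs)" by (metis nth_mem)
    qed
    then show ?thesis unfolding B [symmetric] by blast
  qed
  show "\<forall>v\<in>A. s v \<in> B"
  proof
    fix v assume "v \<in> A"
    then obtain i where "v = vs ! i" "i < h + 1" unfolding A' by blast
    moreover have "s (vs ! i) = vs ! (2 * h + 1 - i)" using \<sigma> \<open>i < h + 1\<close> by auto
    ultimately show "s v \<in> B" unfolding B' by (auto intro!: exI [of _ "2 * h + 1 - i"])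
  qed
  show "\<forall>v\<in>B. s v \<in> A"
  proof
    fix v assume "v \<in> B"
    then obtain i where "v = vs ! i" "h + 1 \<le> i" "i < 2 * h + 2" unfolding B' by blast
    moreover have "s (vs ! i) = vs ! (2 * h + 1 - i)" using \<sigma> \<open>i < 2 * h + 2\<close> by auto
    ultimately show "s v \<in> A" unfolding A' by (auto intro!: exI [of _ "2 * h + 1 - i"])
  qed
  show "\<forall>v\<in>A \<union> B. s (s v) = v"
  proof
    fix v assume "v \<in> A \<union> B"
    then obtain i where i: "v = vs ! i" "i < 2 * h + 2" unfolding A' B' by fastforce
    then have "s v = vs ! (2 * h + 1 - i)" using \<sigma> by auto
    moreover have "s (vs ! (2 * h + 1 - i)) = vs ! (2 * h + 1 - (2 * h + 1 - i))"
      by (rule \<sigma> [rule_format]) simp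
    moreover have "2 * h + 1 - (2 * h + 1 - i) = i" using i(2) by auto
    ultimately show "s (s v) = v" using i by simp
  qed
  show "A \<inter> B = {}"
    unfolding A [symmetric] B [symmetric] using assms(1)
    by (metis append_take_drop_id distinct_append)
qed

lemma move_involution:
  assumes "involution_choice h K \<sigma>" "L \<in> bistellar_class h K" "bistellar_move h L \<alpha> \<beta> L'"
  shows "\<forall>v\<in>\<alpha>. \<sigma> L \<alpha> v \<in> \<beta>" "\<forall>v\<in>\<beta>. \<sigma> L \<alpha> v \<in> \<alpha>"
    "\<forall>v\<in>\<alpha> \<union> \<beta>. \<sigma> L \<alpha> (\<sigma> L \<alpha> v) = v" "\<alpha> \<inter> \<beta> = {}"
proof -
  obtain vs where vs: "positive_listing h L \<alpha> \<beta> vs \<or> positive_listing h L' \<beta> \<alpha> vs"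
    and s: "\<forall>i<2 * h + 2. \<sigma> L \<alpha> (vs ! i) = vs ! (2 * h + 1 - i)"
    using assms unfolding involution_choice_def by blast
  have d: "distinct vs" "length vs = 2 * h + 2"
    using vs by (auto simp: positive_listing_def)
  from vs have "(set (take (h + 1) vs) = \<alpha> \<and> set (drop (h + 1) vs) = \<beta>) \<or>
      (set (take (h + 1) vs) = \<beta> \<and> set (drop (h + 1) vs) = \<alpha>)"
    by (auto simp: positive_listing_def)
  then have *: "(\<forall>v\<in>\<alpha>. \<sigma> L \<alpha> v \<in> \<beta>) \<and> (\<forall>v\<in>\<beta>. \<sigma> L \<alpha> v \<in> \<alpha>) \<and>
      (\<forall>v\<in>\<alpha> \<union> \<beta>. \<sigma> L \<alpha> (\<sigma> L \<alpha> v) = v) \<and> \<alpha> \<inter> \<beta> = {}"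
  proof
    assume "set (take (h + 1) vs) = \<alpha> \<and> set (drop (h + 1) vs) = \<beta>"
    then show ?thesis using bij_nth_involution [OF d s, of \<alpha> \<beta>] by blast
  next
    assume "set (take (h + 1) vs) = \<beta> \<and> set (drop (h + 1) vs) = \<alpha>"
    then show ?thesis using bij_nth_involution [OF d s, of \<beta> \<alpha>] by blast
  qed
  then show "\<forall>v\<in>\<alpha>. \<sigma> L \<alpha> v \<in> \<beta>" "\<forall>v\<in>\<beta>. \<sigma> L \<alpha> v \<in> \<alpha>"
    "\<forall>v\<in>\<alpha> \<union> \<beta>. \<sigma> L \<alpha> (\<sigma> L \<alpha> v) = v" "\<alpha> \<inter> \<beta> = {}" by auto
qed

lemma join_boundaryI:
  "t = a \<union> b \<Longrightarrow> a \<subseteq> \<alpha> \<Longrightarrow> b \<subset> \<beta> \<Longrightarrow> t \<noteq> {} \<Longrightarrow> t \<in> join_boundary \<alpha> \<beta>"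
  unfolding join_boundary_def by blast

lemma image_join_boundary:
  assumes "\<forall>v\<in>A. s v \<in> B" "\<forall>v\<in>B. s v \<in> A" "\<forall>v\<in>A \<union> B. s (s v) = v"
    and "t \<in> join_boundary A B"
  shows "s ` t \<in> join_boundary B A" "s ` s ` t = t" "card (s ` t) = card t"
proof -
  obtain a b where t: "t = a \<union> b" "a \<subseteq> A" "b \<subset> B" "a \<union> b \<noteq> {}"
    using assms(4) unfolding join_boundary_def by blast
  have "s ` b \<noteq> A"
  proof
    assume "s ` b = A"
    moreover obtain y where "y \<in> B" "y \<notin> b" using t by blast
    ultimately obtain z where "z \<in> b" "s y = s z" using assms(2) by (metis imageE)
    then have "y = z" using assms(3) \<open>y \<in> B\<close> t(3) by (metis UnCI psubsetD)
    then show False using \<open>z \<in> b\<close> \<open>y \<notin> b\<close> by simp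
  qed
  then have "s ` a \<subseteq> B" "s ` b \<subset> A" using assms(1,2) t by auto
  then show "s ` t \<in> join_boundary B A"
    unfolding join_boundary_def t(1) image_Un using t(4) by blast
  have "t \<subseteq> A \<union> B" using t by blast
  then show "s ` s ` t = t" using assms(3) by (force simp: image_image)
  have "inj_on s t"
    using \<open>t \<subseteq> A \<union> B\<close> assms(3) by (metis inj_onI subsetD)
  then show "card (s ` t) = card t" by (rule card_image)
qed

definition down_closed :: "face set \<Rightarrow> bool" where
  "down_closed K \<longleftrightarrow> (\<forall>s\<in>K. \<forall>t. t \<subseteq> s \<and> t \<noteq> {} \<longrightarrow> t \<in> K)"

lemma join_boundary_in_complex:
  assumes "bistellar_pair h K \<alpha> \<beta>" "down_closed K"
  shows "join_boundary \<alpha> \<beta> \<subseteq> K"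
proof
  fix t assume "t \<in> join_boundary \<alpha> \<beta>"
  then obtain a b where t: "t = a \<union> b" "a \<subseteq> \<alpha>" "b \<subset> \<beta>" "a \<union> b \<noteq> {}"
    unfolding join_boundary_def by blast
  have \<alpha>: "\<alpha> \<in> K" using assms(1) by (auto simp: bistellar_pair_def simplices_def)
  have "b \<union> \<alpha> \<in> K"
  proof (cases "b = {}")
    case True
    then show ?thesis using \<alpha> by simp
  next
    case False
    then have "b \<in> link K \<alpha>" using assms(1) t(3)
      by (auto simp: bistellar_pair_def simplex_boundary_def)
    then show ?thesis by (simp add: link_def)
  qed
  moreover have "t \<subseteq> b \<union> \<alpha>" using t by blast
  ultimately show "t \<in> K" using assms(2) t unfolding down_closed_def by metis
qed

lemma down_closed_move:
  assumes "bistellar_move h L \<alpha> \<beta> L'" "down_closed (fst L)"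
  shows "down_closed (fst L')"
proof -
  have L': "fst L' = (fst L - join_boundary \<alpha> \<beta>) \<union> join_boundary \<beta> \<alpha>"
    and bp: "bistellar_pair h (fst L) \<alpha> \<beta>"
    using assms(1) by (auto simp: bistellar_move_def)
  show ?thesis
    unfolding down_closed_def
  proof (intro ballI allI impI)
    fix s t assume s: "s \<in> fst L'" and t: "t \<subseteq> s \<and> t \<noteq> {}"
    show "t \<in> fst L'"
    proof (cases "s \<in> join_boundary \<beta> \<alpha>")
      case True
      then obtain a b where "s = a \<union> b" "a \<subseteq> \<beta>" "b \<subset> \<alpha>" unfolding join_boundary_def by blast
      then have "t = (t \<inter> a) \<union> (t \<inter> b)" "t \<inter> a \<subseteq> \<beta>" "t \<inter> b \<subset> \<alpha>"
        using t by blast+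
      then have "t \<in> join_boundary \<beta> \<alpha>" by (rule join_boundaryI) (use t in simp)
      then show ?thesis using L' by simp
    next
      case False
      then have sL: "s \<in> fst L" "s \<notin> join_boundary \<alpha> \<beta>" using s L' by auto
      then have tL: "t \<in> fst L" using assms(2) t unfolding down_closed_def by blast
      show ?thesis
      proof (cases "t \<in> join_boundary \<alpha> \<beta>")
        case False
        then show ?thesis using tL L' by blast
      next
        case True
        then obtain a b where ab: "t = a \<union> b" "a \<subseteq> \<alpha>" "b \<subset> \<beta>" unfolding join_boundary_def by blast
        have "a \<noteq> \<alpha>"
        proof
          assume "a = \<alpha>"
          then have sub: "\<alpha> \<subseteq> s" using ab t by blast
          show False
          proof (cases "s = \<alpha>")
            case True
            have "{} \<subset> \<beta>" using bp by (auto simp: bistellar_pair_def)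
            then have "s \<in> join_boundary \<alpha> \<beta>"
              by (intro join_boundaryI [of s \<alpha> "{}"]) (use True t in auto)
            then show False using sL(2) by simp
          next
            case False
            then have "s - \<alpha> \<in> link (fst L) \<alpha>"
              using sub sL(1) by (auto simp: link_def Un_absorb2)
            then have "s - \<alpha> \<subset> \<beta>"
              using bp by (auto simp: bistellar_pair_def simplex_boundary_def)
            moreover have "s = \<alpha> \<union> (s - \<alpha>)" using sub by blast
            ultimately have "s \<in> join_boundary \<alpha> \<beta>"
              by (intro join_boundaryI [of s \<alpha> "s - \<alpha>"]) (use t in auto)
            then show False using sL(2) by simp
          qed
        qed
        then have "t = b \<union> a" "b \<subseteq> \<beta>" "a \<subset> \<alpha>" using ab by auto
        then have "t \<in> join_boundary \<beta> \<alpha>" by (rule join_boundaryI) (use t in simp)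
        then show ?thesis using L' by blast
      qed
    qed
  qed
qed

lemma down_closed_class:
  assumes "K \<in> triangulated_manifolds n" "L \<in> bistellar_class h K"
  shows "down_closed (fst L)"
proof -
  have "(\<lambda>T T'. \<exists>\<alpha> \<beta>. bistellar_move h T \<alpha> \<beta> T')\<^sup>*\<^sup>* K L"
    using assms(2) by (simp add: bistellar_class_def)
  then show ?thesis
  proof induction
    case base
    have "simplicial_complex (fst K)"
      using assms(1) by (cases K) (simp add: triangulated_manifolds_def)
    then show ?case unfolding simplicial_complex_def down_closed_def by (elim conjE)
  next
    case (step T T')
    then show ?case using down_closed_move by metis
  qed
qed

lemma bistellar_class_move:
  "L \<in> bistellar_class h K \<Longrightarrow> bistellar_move h L \<alpha> \<beta> L' \<Longrightarrow> L' \<in> bistellar_class h K"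
  unfolding bistellar_class_def by (auto intro: rtranclp.rtrancl_into_rtrancl)

lemma move_facets:
  assumes inv: "involution_choice h K \<sigma>" and L: "L \<in> bistellar_class h K"
    and mv: "bistellar_move h L \<alpha> \<beta> L'" and dc: "down_closed (fst L)"
  shows "facets_join h \<alpha> \<beta> \<subseteq> facets h L"
    and "g \<in> common_facets h \<alpha> \<beta> \<Longrightarrow> \<sigma> L \<alpha> ` g \<in> facets h L"
    and "f \<in> facets h L' \<Longrightarrow> f \<notin> facets h L \<Longrightarrow> \<exists>g\<in>exchanged_facets h \<alpha> \<beta>. f = \<sigma> L \<alpha> ` g"
proof -
  let ?s = "\<sigma> L \<alpha>"
  note i = move_involution [OF inv L mv]
  have i': "\<forall>v\<in>\<beta> \<union> \<alpha>. ?s (?s v) = v" using i(3) by blast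
  have bp: "bistellar_pair h (fst L) \<alpha> \<beta>"
    and L': "fst L' = (fst L - join_boundary \<alpha> \<beta>) \<union> join_boundary \<beta> \<alpha>"
    using mv by (auto simp: bistellar_move_def)
  show sub: "facets_join h \<alpha> \<beta> \<subseteq> facets h L"
    using join_boundary_in_complex [OF bp dc] by (auto simp: facets_join_def facets_def simplices_def)
  have im: "?s ` t \<in> facets_join h \<beta> \<alpha>" "?s ` ?s ` t = t" if "t \<in> facets_join h \<alpha> \<beta>" for t
    using that image_join_boundary [OF i(1-3), of t] by (auto simp: facets_join_def simplices_def)
  have im': "?s ` t \<in> facets_join h \<alpha> \<beta>" "?s ` ?s ` t = t" if "t \<in> facets_join h \<beta> \<alpha>" for t
    using that image_join_boundary [OF i(2,1) i', of t] by (auto simp: facets_join_def simplices_def)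
  show "?s ` g \<in> facets h L" if "g \<in> common_facets h \<alpha> \<beta>"
    using im' [of g] that sub by (auto simp: common_facets_def exchanged_facets_def)
  assume f: "f \<in> facets h L'" "f \<notin> facets h L"
  then have f1: "f \<in> facets_join h \<beta> \<alpha>" "f \<notin> facets_join h \<alpha> \<beta>"
    using L' sub by (auto simp: facets_def facets_join_def simplices_def)
  then have "?s ` f \<in> facets_join h \<alpha> \<beta>" "f = ?s ` ?s ` f" using im' [of f] by auto
  moreover have "?s ` f \<notin> facets_join h \<beta> \<alpha>"
    using im'(1) [of "?s ` f"] f1 im'(2) [of f] by metis
  ultimately show "\<exists>g\<in>exchanged_facets h \<alpha> \<beta>. f = ?s ` g"
    unfolding exchanged_facets_def by blast
qed

lemma of_monomial_sum: "of_monomial (sum m I) = (\<Prod>i\<in>I. of_monomial (m i))"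
  by (induction I rule: infinite_finite_induct) (simp_all add: of_monomial_add)

lemma subset_monomial_in_cluster_field:
  assumes "\<And>v. v \<in> Poly_Mapping.keys m \<Longrightarrow> \<exists>f\<in>facets h L. v = sorted_list_of_set f"
  shows "(of_monomial m :: 'p::semifield ratfun) \<in> cluster_field h L"
proof -
  have "m = (\<Sum>v\<in>Poly_Mapping.keys m. Poly_Mapping.single v (Poly_Mapping.lookup m v))"
    by (rule poly_mapping_eqI)
      (auto simp: lookup_sum lookup_single when_def in_keys_iff)
  then have "(of_monomial m :: 'p ratfun) = (\<Prod>v\<in>Poly_Mapping.keys m. of_monomial (Poly_Mapping.single v (Poly_Mapping.lookup m v)))"
    using of_monomial_sum by metis
  moreover have "(of_monomial (Poly_Mapping.single v (Poly_Mapping.lookup m v)) :: 'p ratfun) \<in> cluster_field h L"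
    if v: "v \<in> Poly_Mapping.keys m" for v
  proof -
    obtain f where f: "f \<in> facets h L" "v = sorted_list_of_set f" using assms v by blast
    then have "(of_monomial (Poly_Mapping.single v (Poly_Mapping.lookup m v)) :: 'p ratfun) = var f ^ Poly_Mapping.lookup m v"
      using of_monomial_var_monomial [of f "Poly_Mapping.lookup m v"] by (simp add: var_monomial_def)
    then show ?thesis using f(1) by (simp add: power_in_cluster_field var_in_cluster_field)
  qed
  ultimately show ?thesis by (simp add: prod_in_cluster_field)
qed

lemma exchange_rhs_in_cluster_field:
  assumes "\<And>g. g \<in> common_facets h \<alpha> \<beta> \<Longrightarrow> g \<in> facets h L \<and> \<sigma> L \<alpha> ` g \<in> facets h L"
  shows "exchange_rhs h \<sigma> p L \<alpha> \<beta> f \<in> cluster_field h L"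
proof -
  have D: "exchange_denominator h \<sigma> L \<alpha> \<beta> f \<in> cluster_field h L"
    unfolding exchange_denominator_def
    by (intro prod_in_cluster_field cluster_field_quotient power_in_cluster_field var_in_cluster_field)
      (auto dest: assms)
  have T: "exchange_term h \<sigma> q s L \<alpha> \<beta> f \<in> cluster_field h L" for q :: 'a and s
    unfolding exchange_term_def semifield_scalar_def
  proof (intro cluster_field_quotient D scalar_in_cluster_field subset_monomial_in_cluster_field)
    fix v
    let ?c = "common_facets h \<alpha> \<beta>"
    let ?e = "\<lambda>g. nat (max (s * exchange_matrix h L f g) 0)"
    let ?a = "\<Sum>g\<in>?c. var_monomial g (?e g)" and ?b = "\<Sum>g\<in>?c. var_monomial (\<sigma> L \<alpha> ` g) (?e g)"
    assume "v \<in> Poly_Mapping.keys (lcm_monomial ?a ?b)"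
    then have "Poly_Mapping.lookup ?a v \<noteq> 0 \<or> Poly_Mapping.lookup ?b v \<noteq> 0"
      by (auto simp: in_keys_iff lcm_monomial.rep_eq max_def split: if_splits)
    then have "\<exists>g\<in>?c. v = sorted_list_of_set g \<or> v = sorted_list_of_set (\<sigma> L \<alpha> ` g)"
    proof
      assume "Poly_Mapping.lookup ?a v \<noteq> 0"
      then have "\<exists>g\<in>?c. Poly_Mapping.lookup (var_monomial g (?e g)) v \<noteq> 0"
        unfolding lookup_sum by (meson sum.neutral)
      then show ?thesis by (auto simp: var_monomial_def lookup_single when_def split: if_splits)
    next
      assume "Poly_Mapping.lookup ?b v \<noteq> 0"
      then have "\<exists>g\<in>?c. Poly_Mapping.lookup (var_monomial (\<sigma> L \<alpha> ` g) (?e g)) v \<noteq> 0"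
        unfolding lookup_sum by (meson sum.neutral)
      then show ?thesis by (auto simp: var_monomial_def lookup_single when_def split: if_splits)
    qed
    then show "\<exists>f\<in>facets h L. v = sorted_list_of_set f" using assms by blast
  qed
  show ?thesis unfolding exchange_rhs_def by (intro cluster_field_quotient T)
qed

text \<open>Homomorphisms on \<open>\<bbbF>\<X>(L)\<close> are determined by the cluster variables.\<close>

lemma cluster_field_hom_eqI:
  fixes \<phi> \<psi> :: "'p::semifield ratfun \<Rightarrow> 'f::field"
  assumes hom: "\<And>x y. x \<in> cluster_field h L \<Longrightarrow> y \<in> cluster_field h L \<Longrightarrow>
        \<phi> (x + y) = \<phi> x + \<phi> y \<and> \<phi> (x * y) = \<phi> x * \<phi> y"
      "\<And>x y. x \<in> cluster_field h L \<Longrightarrow> y \<in> cluster_field h L \<Longrightarrow>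
        \<psi> (x + y) = \<psi> x + \<psi> y \<and> \<psi> (x * y) = \<psi> x * \<psi> y"
    and sc: "\<And>c. \<phi> (scalar c) = \<psi> (scalar c)"
    and var: "\<And>f. f \<in> facets h L \<Longrightarrow> \<phi> (var f) = \<psi> (var f)"
    and nz: "\<And>x. x \<in> cluster_field h L \<Longrightarrow> x \<noteq> 0 \<Longrightarrow> \<phi> x \<noteq> 0"
    and z: "z \<in> cluster_field h L"
  shows "\<phi> z = \<psi> z"
proof -
  let ?A = "subalgebra_generated scalar (cluster h L) :: 'p ratfun set"
  have sub: "x \<in> cluster_field h L" if "x \<in> ?A" for x
    using that subalgebra_in_cluster_field by blast
  have A: "\<phi> x = \<psi> x" if "x \<in> ?A" for x
    using that
  proof induction
    case (gen x)
    then show ?case using var by (auto simp: cluster_def)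
  next
    case (add x y)
    then show ?case using hom(1) [of x y] hom(2) [of x y] sub by simp
  next
    case (mult x y)
    then show ?case using hom(1) [of x y] hom(2) [of x y] sub by simp
  qed (rule sc)
  obtain a b where ab: "z = a / b" "a \<in> ?A" "b \<in> ?A" "b \<noteq> 0"
    using z unfolding cluster_field_def by blast
  have in': "a \<in> cluster_field h L" "b \<in> cluster_field h L"
    by (rule sub [OF ab(2)], rule sub [OF ab(3)])
  have "\<phi> z * \<phi> b = \<phi> a" "\<psi> z * \<psi> b = \<psi> a"
    using hom(1) [OF z in'(2)] hom(2) [OF z in'(2)] ab by auto
  then have "\<phi> z * \<phi> b = \<psi> z * \<phi> b" using A ab by metis
  then show ?thesis using nz in'(2) ab(4) by simp
qed

context
  fixes h :: nat and K :: oriented_complex and \<sigma> :: involutions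
    and p :: "'p::semifield seeds" and \<kappa> :: "'p group_ring \<Rightarrow> 'f::field"
    and \<iota> :: "oriented_complex \<Rightarrow> 'p ratfun \<Rightarrow> 'f"
  assumes man: "K \<in> triangulated_manifolds (2 * h)"
    and inv: "involution_choice h K \<sigma>"
    and sf: "single_field h K \<sigma> p \<kappa> \<iota>"
begin

lemma single_field_rules:
  assumes "L \<in> bistellar_class h K"
  shows "inj_on (\<iota> L) (cluster_field h L)" "\<iota> L ` cluster_field h L = UNIV"
    "\<And>x y. x \<in> cluster_field h L \<Longrightarrow> y \<in> cluster_field h L \<Longrightarrow> \<iota> L (x + y) = \<iota> L x + \<iota> L y"
    "\<And>x y. x \<in> cluster_field h L \<Longrightarrow> y \<in> cluster_field h L \<Longrightarrow> \<iota> L (x * y) = \<iota> L x * \<iota> L y"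
    "\<iota> L (scalar c) = \<kappa> c"
  using sf assms unfolding single_field_def bij_betw_def by blast+

lemma single_field_nonzero:
  assumes "L \<in> bistellar_class h K" "x \<in> cluster_field h L" "x \<noteq> 0"
  shows "\<iota> L x \<noteq> 0"
proof
  assume "\<iota> L x = 0"
  have 0: "0 \<in> cluster_field h L" using scalar_in_cluster_field [of 0] by simp
  have "\<iota> L 0 = \<iota> L 0 + \<iota> L 0" using single_field_rules(3) [OF assms(1) 0 0] by simp
  then have "\<iota> L 0 = 0" by (metis add_cancel_right_right)
  then have "\<iota> L x = \<iota> L 0" using \<open>\<iota> L x = 0\<close> by simp
  then show False using single_field_rules(1) [OF assms(1)] assms 0 by (auto dest: inj_onD)
qed

lemma single_field_move:
  assumes L: "L \<in> bistellar_class h K" and mv: "bistellar_move h L \<alpha> \<beta> L'"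
  shows "f \<in> facets h L \<Longrightarrow> f \<in> facets h L' \<Longrightarrow> \<iota> L' (var f) = \<iota> L (var f)"
    and "f \<in> exchanged_facets h \<alpha> \<beta> \<Longrightarrow>
      \<iota> L (var f) * \<iota> L' (var (\<sigma> L \<alpha> ` f)) = \<iota> L (exchange_rhs h \<sigma> p L \<alpha> \<beta> f)"
  using sf L mv unfolding single_field_def by blast+

lemma rhs_in:
  assumes L: "L \<in> bistellar_class h K" and mv: "bistellar_move h L \<alpha> \<beta> L'"
  shows "exchange_rhs h \<sigma> p L \<alpha> \<beta> f \<in> cluster_field h L"
proof (rule exchange_rhs_in_cluster_field)
  fix g assume "g \<in> common_facets h \<alpha> \<beta>"
  then show "g \<in> facets h L \<and> \<sigma> L \<alpha> ` g \<in> facets h L"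
    using move_facets(1,2) [OF inv L mv down_closed_class [OF man L]]
    by (auto simp: common_facets_def)
qed

lemma exchanged_in:
  assumes L: "L \<in> bistellar_class h K" and mv: "bistellar_move h L \<alpha> \<beta> L'"
    and f: "f \<in> exchanged_facets h \<alpha> \<beta>"
  shows "var f \<in> cluster_field h L"
  using move_facets(1) [OF inv L mv down_closed_class [OF man L]] f
  by (auto simp: exchanged_facets_def intro: var_in_cluster_field)

lemma identification_exists:
  assumes L: "L \<in> bistellar_class h K" and mv: "bistellar_move h L \<alpha> \<beta> L'"
  shows "\<exists>\<phi>. exchange_identification h \<sigma> p L \<alpha> \<beta> L' \<phi>"
proof -
  have L': "L' \<in> bistellar_class h K" using bistellar_class_move L mv .
  define \<phi> where "\<phi> = inv_into (cluster_field h L) (\<iota> L) \<circ> \<iota> L'"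
  have b: "bij_betw (\<iota> L) (cluster_field h L) UNIV" "bij_betw (\<iota> L') (cluster_field h L') UNIV"
    using single_field_rules(1,2) L L' unfolding bij_betw_def by auto
  have bij: "bij_betw \<phi> (cluster_field h L') (cluster_field h L)"
    unfolding \<phi>_def using bij_betw_trans [OF b(2) bij_betw_inv_into [OF b(1)]] .
  have in\<phi>: "\<phi> x \<in> cluster_field h L" for x
    unfolding \<phi>_def using inv_into_into [of "\<iota> L' x" "\<iota> L" "cluster_field h L"]
      single_field_rules(2) [OF L] by simp
  have \<iota>\<phi>: "\<iota> L (\<phi> x) = \<iota> L' x" for x
    unfolding \<phi>_def using f_inv_into_f [of "\<iota> L' x" "\<iota> L" "cluster_field h L"]
      single_field_rules(2) [OF L] by simp
  have eqI: "\<phi> x = y" if "\<iota> L' x = \<iota> L y" "y \<in> cluster_field h L" for x y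
    using inj_onD [OF single_field_rules(1) [OF L], of "\<phi> x" y] that in\<phi> \<iota>\<phi> by simp
  have "algebra_isomorphism (cluster_field h L') (cluster_field h L) \<phi>"
    unfolding algebra_isomorphism_def
  proof (intro conjI ballI allI bij)
    fix x y :: "'p ratfun"
    assume xy: "x \<in> cluster_field h L'" "y \<in> cluster_field h L'"
    show "\<phi> (x + y) = \<phi> x + \<phi> y" "\<phi> (x * y) = \<phi> x * \<phi> y"
      by (rule eqI; simp add: single_field_rules(3,4) [OF L'] single_field_rules(3,4) [OF L]
          xy in\<phi> \<iota>\<phi> cluster_field_quotient)+
  next
    fix c show "\<phi> (scalar c) = scalar c"
      by (rule eqI) (simp_all add: single_field_rules(5) L L' scalar_in_cluster_field)
  qed
  moreover have "\<phi> (var f) = var f" if "f \<in> facets h L \<inter> facets h L'" for f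
    by (rule eqI) (use that in \<open>simp_all add: single_field_move(1) [OF L mv] var_in_cluster_field\<close>)
  moreover have "\<phi> (var (\<sigma> L \<alpha> ` f)) = exchange_rhs h \<sigma> p L \<alpha> \<beta> f / var f"
    if f: "f \<in> exchanged_facets h \<alpha> \<beta>" for f
  proof (rule eqI)
    let ?r = "exchange_rhs h \<sigma> p L \<alpha> \<beta> f"
    have v: "var f \<in> cluster_field h L" by (rule exchanged_in [OF L mv f])
    have r: "?r \<in> cluster_field h L" by (rule rhs_in [OF L mv])
    show q: "?r / var f \<in> cluster_field h L" by (rule cluster_field_quotient(1) [OF r v])
    have "\<iota> L (var f) * \<iota> L (?r / var f) = \<iota> L (var f) * \<iota> L' (var (\<sigma> L \<alpha> ` f))"
      unfolding single_field_move(2) [OF L mv f]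
      by (simp add: single_field_rules(4) [OF L v q, symmetric])
    then show "\<iota> L' (var (\<sigma> L \<alpha> ` f)) = \<iota> L (?r / var f)"
      using single_field_nonzero [OF L v] by simp
  qed
  ultimately show ?thesis unfolding exchange_identification_def using mv by blast
qed

lemma identification_unique:
  assumes L: "L \<in> bistellar_class h K" and id: "exchange_identification h \<sigma> p L \<alpha> \<beta> L' \<phi>"
    and z: "z \<in> cluster_field h L'"
  shows "\<iota> L (\<phi> z) = \<iota> L' z"
proof -
  have mv: "bistellar_move h L \<alpha> \<beta> L'"
    and iso: "algebra_isomorphism (cluster_field h L') (cluster_field h L) \<phi>"
    and com: "\<And>f. f \<in> facets h L \<inter> facets h L' \<Longrightarrow> \<phi> (var f) = var f"
    and ex: "\<And>f. f \<in> exchanged_facets h \<alpha> \<beta> \<Longrightarrow>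
      \<phi> (var (\<sigma> L \<alpha> ` f)) = exchange_rhs h \<sigma> p L \<alpha> \<beta> f / var f"
    using id unfolding exchange_identification_def by blast+
  have L': "L' \<in> bistellar_class h K" using bistellar_class_move L mv .
  have in\<phi>: "\<phi> x \<in> cluster_field h L" if "x \<in> cluster_field h L'" for x
    using iso that unfolding algebra_isomorphism_def bij_betw_def by blast
  have \<phi>hom: "\<phi> (x + y) = \<phi> x + \<phi> y" "\<phi> (x * y) = \<phi> x * \<phi> y"
    if "x \<in> cluster_field h L'" "y \<in> cluster_field h L'" for x y
    using iso that unfolding algebra_isomorphism_def by blast+
  have "\<iota> L' z = (\<iota> L \<circ> \<phi>) z"
  proof (rule cluster_field_hom_eqI [where h = h and L = L'])
    show "\<iota> L' (scalar c) = (\<iota> L \<circ> \<phi>) (scalar c)" for c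
      using iso single_field_rules(5) L L' by (simp add: algebra_isomorphism_def)
    show "\<iota> L' (var f) = (\<iota> L \<circ> \<phi>) (var f)" if f: "f \<in> facets h L'" for f
    proof (cases "f \<in> facets h L")
      case True
      then show ?thesis using f com single_field_move(1) [OF L mv] by simp
    next
      case False
      then obtain g where g: "g \<in> exchanged_facets h \<alpha> \<beta>" "f = \<sigma> L \<alpha> ` g"
        using move_facets(3) [OF inv L mv down_closed_class [OF man L] f] by blast
      let ?r = "exchange_rhs h \<sigma> p L \<alpha> \<beta> g"
      have v: "var g \<in> cluster_field h L" by (rule exchanged_in [OF L mv g(1)])
      have q: "?r / var g \<in> cluster_field h L"
        by (rule cluster_field_quotient(1) [OF rhs_in [OF L mv] v])
      have "\<iota> L (var g) * \<iota> L (?r / var g) = \<iota> L (var g) * \<iota> L' (var f)"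
        unfolding g(2) single_field_move(2) [OF L mv g(1)]
        by (simp add: single_field_rules(4) [OF L v q, symmetric])
      then show ?thesis using single_field_nonzero [OF L v] ex [OF g(1)] g(2) by simp
    qed
  qed (use single_field_rules(3,4) [OF L'] single_field_rules(3,4) [OF L] \<phi>hom in\<phi>
      single_field_nonzero [OF L'] z in auto)
  then show ?thesis by simp
qed

lemma identified_equal:
  assumes "identified h K \<sigma> p L z L' z'"
  shows "\<iota> L z = \<iota> L' z'"
  using assms by induction (auto intro: identification_unique)

lemma identified_mem:
  assumes "identified h K \<sigma> p L z L' z'"
  shows "z \<in> cluster_field h L \<and> z' \<in> cluster_field h L'"
  using assms
proof induction
  case (step L \<alpha> \<beta> L' \<phi> z)
  then show ?case
    unfolding exchange_identification_def algebra_isomorphism_def bij_betw_def by blast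
qed auto

lemma identified_exists:
  assumes "L \<in> bistellar_class h K" "z' \<in> cluster_field h L"
  shows "\<exists>z. identified h K \<sigma> p K z L z'"
proof -
  have "(\<lambda>T T'. \<exists>\<alpha> \<beta>. bistellar_move h T \<alpha> \<beta> T')\<^sup>*\<^sup>* K L"
    using assms(1) by (simp add: bistellar_class_def)
  then show ?thesis using assms(2)
  proof (induction arbitrary: z')
    case base
    then show ?case by (auto intro!: exI identified.refl simp: bistellar_class_def)
  next
    case (step T T')
    then obtain \<alpha> \<beta> where mv: "bistellar_move h T \<alpha> \<beta> T'" by blast
    have T: "T \<in> bistellar_class h K" using step by (simp add: bistellar_class_def)
    obtain \<phi> where \<phi>: "exchange_identification h \<sigma> p T \<alpha> \<beta> T' \<phi>"
      using identification_exists [OF T mv] by blast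
    have id: "identified h K \<sigma> p T (\<phi> z') T' z'"
      by (rule identified.step [OF T \<phi> step.prems])
    then obtain z where "identified h K \<sigma> p K z T (\<phi> z')"
      using step.IH identified_mem by blast
    then show ?case using id identified.trans by blast
  qed
qed

theorem bistellar_cluster_algebra_in_single_field:
  "\<iota> K ` bistellar_cluster_algebra h \<sigma> p K =
   subalgebra_generated \<kappa> (\<Union>L\<in>bistellar_class h K. \<iota> L ` cluster h L)"
proof -
  let ?G = "{z. \<exists>L\<in>bistellar_class h K. \<exists>f\<in>facets h L. identified h K \<sigma> p K z L (var f)}"
  let ?A = "subalgebra_generated scalar ?G :: 'p ratfun set"
  let ?H = "\<Union>L\<in>bistellar_class h K. \<iota> L ` cluster h L"
  have K: "K \<in> bistellar_class h K" by (simp add: bistellar_class_def)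
  have mem: "x \<in> cluster_field h K" if "x \<in> ?A" for x
    using that by induction (auto intro: scalar_in_cluster_field cluster_field_quotient
        dest: identified_mem)
  have "\<iota> K x \<in> subalgebra_generated \<kappa> ?H" if "x \<in> ?A" for x
    using that
  proof induction
    case (scalar c)
    then show ?case by (simp add: single_field_rules(5) [OF K] subalgebra_generated.scalar)
  next
    case (gen z)
    then obtain L f where "L \<in> bistellar_class h K" "f \<in> facets h L" "\<iota> K z = \<iota> L (var f)"
      using identified_equal by blast
    then show ?case by (auto intro!: subalgebra_generated.gen simp: cluster_def)
  next
    case (add x y)
    then show ?case
      by (simp add: single_field_rules(3) [OF K mem mem] subalgebra_generated.add)
  next
    case (mult x y)
    then show ?case
      by (simp add: single_field_rules(4) [OF K mem mem] subalgebra_generated.mult)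
  qed
  moreover have "w \<in> \<iota> K ` ?A" if "w \<in> subalgebra_generated \<kappa> ?H" for w
    using that
  proof induction
    case (scalar c)
    show ?case
      unfolding single_field_rules(5) [OF K, symmetric]
      by (intro imageI subalgebra_generated.scalar)
  next
    case (gen w)
    then obtain L f where Lf: "L \<in> bistellar_class h K" "f \<in> facets h L" "w = \<iota> L (var f)"
      unfolding cluster_def by blast
    then obtain z where "identified h K \<sigma> p K z L (var f)"
      using identified_exists var_in_cluster_field by blast
    then have z: "z \<in> ?G" "\<iota> K z = w" using Lf identified_equal by blast+
    show ?case
      unfolding z(2) [symmetric] by (intro imageI subalgebra_generated.gen z(1))
  next
    case (add x y)
    then obtain a b where "x = \<iota> K a" "y = \<iota> K b" and ab: "a \<in> ?A" "b \<in> ?A" by blast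
    then have eq: "x + y = \<iota> K (a + b)" using single_field_rules(3) [OF K mem mem] by simp
    show ?case
      unfolding eq by (intro imageI subalgebra_generated.add ab)
  next
    case (mult x y)
    then obtain a b where "x = \<iota> K a" "y = \<iota> K b" and ab: "a \<in> ?A" "b \<in> ?A" by blast
    then have eq: "x * y = \<iota> K (a * b)" using single_field_rules(4) [OF K mem mem] by simp
    show ?case
      unfolding eq by (intro imageI subalgebra_generated.mult ab)
  qed
  ultimately show ?thesis
    unfolding bistellar_cluster_algebra_def by (intro equalityI subsetI) (elim imageE, simp)
qed

end

end

theory Submission imports Defs begin

text \<open>For a single move from \<open>L\<close> to \<open>L'\<close>, the substitution sending \<open>x\<^sub>f\<close> to
  \<open>(M\<^sup>+ + M\<^sup>-) / x\<^sub>\<sigma>\<^sub>f\<close> for \<open>f \<in> \<D>\<^sub>\<alpha> \<union> \<D>\<^sub>\<beta>\<close> and fixing all other variables is an involution of the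
  field of rational functions, because \<open>M\<^sup>\<plusminus>\<close> involves only facets common to \<open>\<Lambda>\<^sub>\<alpha>\<close> and
  \<open>\<Lambda>\<^sub>\<beta>\<close>.  It restricts to the identification of \<open>\<bbbF>\<X>(L')\<close> with \<open>\<bbbF>\<X>(L)\<close>, and this carries the
  elements of \<open>\<bbbF>\<X>(L')\<close> identified with cluster variables onto those of \<open>\<bbbF>\<X>(L)\<close>, provided that
  \<open>[L] = [L']\<close>.  The latter means that moves are reversible as moves of oriented complexes:
  the cycle condition is preserved by moves, and it determines the orientation of \<open>L\<close> on
  \<open>\<Lambda>\<^sub>\<alpha>\<close>.\<close>

section \<open>Signs and boundaries\<close>

text \<open>The inversions at the first position correspond to the entries smaller than
  \<open>x\<close>; the others are the inversions of \<open>xs\<close>, shifted by one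
  position.\<close>

lemma list_sign_Cons:
  assumes "x \<notin> set xs" "distinct xs"
  shows "list_sign (x # xs) = (-1) ^ card {y\<in>set xs. y < x} * list_sign xs"
proof -
  let ?I = "{(i, j). i < j \<and> j < length (x # xs) \<and> (x # xs) ! j < (x # xs) ! i}"
  let ?J = "{(i, j). i < j \<and> j < length xs \<and> xs ! j < xs ! i}"
  let ?H = "{j. j < length xs \<and> xs ! j < x}"
  have split: "?I = Pair 0 ` Suc ` ?H \<union> map_prod Suc Suc ` ?J" (is "_ = ?A \<union> ?B")
  proof (intro set_eqI iffI)
    fix z assume "z \<in> ?I"
    then obtain i j where z: "z = (i, j)" "i < j" "j < length (x # xs)" "(x # xs) ! j < (x # xs) ! i"
      by blast
    obtain j' where j: "j = Suc j'" using z(2) by (cases j) auto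
    show "z \<in> ?A \<union> ?B"
    proof (cases i)
      case 0
      then have "j' \<in> ?H" using z j by simp
      then show ?thesis using z(1) 0 j by blast
    next
      case (Suc i')
      then have "(i', j') \<in> ?J" using z j by simp
      then have "map_prod Suc Suc (i', j') \<in> ?B" by (rule imageI)
      then show ?thesis using z(1) Suc j by simp
    qed
  qed auto
  have J: "finite ?J"
    by (rule finite_subset [of _ "{..<length xs} \<times> {..<length xs}"]) auto
  have "card ?I = card ?A + card ?B"
    unfolding split by (rule card_Un_disjoint) (use J in auto)
  also have "card ?B = card ?J" by (intro card_image) (auto simp: inj_on_def)
  also have "card ?A = card ?H"
    by (simp add: card_image inj_on_def)
  also have "card ?H = card {y\<in>set xs. y < x}"
  proof (rule bij_betw_same_card [of "(!) xs"])
    show "bij_betw ((!) xs) ?H {y\<in>set xs. y < x}"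
      unfolding bij_betw_def
      by (auto simp: inj_on_def nth_eq_iff_index_eq [OF assms(2)] in_set_conv_nth)
  qed
  finally show ?thesis by (simp add: list_sign_def power_add)
qed

lemma list_sign_cases: "list_sign vs = 1 \<or> list_sign vs = -1"
  unfolding list_sign_def using neg_one_even_power neg_one_odd_power by blast

text \<open>The entry \<open>v\<close> is inverted with the larger entries of \<open>us\<close> and
  the smaller entries of \<open>ws\<close>. Modulo 2 their number is \<open>length us\<close> plus
  the number of all smaller entries, which is the rank of \<open>v\<close>.\<close>

lemma list_sign_remove:
  assumes "distinct (us @ v # ws)"
  shows "(-1) ^ length us * list_sign (us @ ws)
    = (-1) ^ vertex_index (set (us @ v # ws)) v * list_sign (us @ v # ws)"
  using assms
proof (induction us)
  case Nil
  have "{u\<in>set (v # ws). u < v} = {y\<in>set ws. y < v}" by auto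
  then show ?case using Nil
    by (simp add: vertex_index_def list_sign_Cons flip: mult.assoc power_add mult_2)
next
  case (Cons u us)
  let ?c = "card {y\<in>set (us @ ws). y < u}"
  let ?d = "card {y\<in>set (us @ v # ws). y < v}"
  have IH: "(-1) ^ length us * list_sign (us @ ws) = (-1) ^ ?d * list_sign (us @ v # ws)"
    using Cons by (simp add: vertex_index_def)
  have l: "list_sign (u # us @ ws) = (-1) ^ ?c * list_sign (us @ ws)"
    by (rule list_sign_Cons) (use Cons.prems in auto)
  have r: "list_sign (u # us @ v # ws)
      = (-1) ^ card {y\<in>set (us @ v # ws). y < u} * list_sign (us @ v # ws)"
    by (rule list_sign_Cons) (use Cons.prems in auto)
  have fin: "finite {y\<in>set (us @ v # ws). P y}" "finite {y\<in>set (us @ ws). P y}" for P by simp_all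
  consider "u < v" | "v < u" using Cons.prems by fastforce
  \<comment> \<open>The new entry \<open>u\<close> either raises the rank of \<open>v\<close> or is
    inverted with \<open>v\<close>. In both cases one sign arises, which matches the additional
    position in front of \<open>v\<close>.\<close>
  then have "(-1::int) ^ (card {y\<in>set (u # us @ v # ws). y < v} + card {y\<in>set (us @ v # ws). y < u})
    = - ((-1) ^ (?d + ?c))"
  proof cases
    case 1
    then have "{y\<in>set (u # us @ v # ws). y < v} = insert u {y\<in>set (us @ v # ws). y < v}" by auto
    moreover have "u \<notin> {y\<in>set (us @ v # ws). y < v}" using Cons.prems by simp
    ultimately have "card {y\<in>set (u # us @ v # ws). y < v} = Suc ?d"
      by (metis card_insert_disjoint fin(1))
    moreover have "{y\<in>set (us @ v # ws). y < u} = {y\<in>set (us @ ws). y < u}" using 1 by auto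
    ultimately show ?thesis by simp
  next
    case 2
    then have "{y\<in>set (us @ v # ws). y < u} = insert v {y\<in>set (us @ ws). y < u}" by auto
    moreover have "v \<notin> {y\<in>set (us @ ws). y < u}" using Cons.prems by simp
    ultimately have "card {y\<in>set (us @ v # ws). y < u} = Suc ?c"
      by (metis card_insert_disjoint fin(2))
    moreover have "{y\<in>set (u # us @ v # ws). y < v} = {y\<in>set (us @ v # ws). y < v}" using 2 by auto
    ultimately show ?thesis by simp
  qed
  then have "(-1) ^ card {y\<in>set (u # us @ v # ws). y < v} * list_sign (u # us @ v # ws)
      = - ((-1) ^ ?c * ((-1) ^ ?d * list_sign (us @ v # ws)))"
    unfolding r by (simp add: power_add flip: mult.assoc)
  also have "\<dots> = - ((-1) ^ ?c * ((-1) ^ length us * list_sign (us @ ws)))" by (simp only: IH)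
  also have "\<dots> = (-1) ^ length (u # us) * list_sign (u # us @ ws)" unfolding l by simp
  finally show ?case by (simp add: vertex_index_def)
qed

text \<open>This is the coefficient of \<open>V \<setminus> {v}\<close> in the boundary of the simplex \<open>V\<close>.\<close>

definition vertex_sign :: "face \<Rightarrow> nat \<Rightarrow> int" where
  "vertex_sign V v = (-1) ^ vertex_index V v"

lemma vertex_sign_square [simp]: "vertex_sign V v * vertex_sign V v = 1"
  by (simp add: vertex_sign_def flip: power_add mult_2)

lemma list_sign_remove_nth:
  assumes "distinct vs" "i < length vs"
  shows "(-1) ^ i * list_sign (take i vs @ drop (i + 1) vs)
    = vertex_sign (set vs) (vs ! i) * list_sign vs"
proof -
  have "vs = take i vs @ vs ! i # drop (i + 1) vs"
    using assms(2) by (simp add: id_take_nth_drop)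
  then show ?thesis
    using list_sign_remove [of "take i vs" "vs ! i" "drop (i + 1) vs"] assms
    by (simp add: vertex_sign_def min_def)
qed

text \<open>Exchanging the first two entries flips the sign and keeps both blocks, which is why
  \<open>A\<close> has at least two elements. This supplies the listing for an inverse move.\<close>

lemma exists_listing_with_sign:
  assumes "finite A" "finite B" "A \<inter> B = {}" "card A \<ge> 2" "s = 1 \<or> s = (-1::int)"
  shows "\<exists>vs. distinct vs \<and> length vs = card A + card B \<and> set (take (card A) vs) = A \<and>
    set (drop (card A) vs) = B \<and> list_sign vs = s"
proof -
  obtain xs ys where xs: "set xs = A" "distinct xs" and ys: "set ys = B" "distinct ys"
    using assms(1,2) finite_distinct_list by meson
  have len: "length xs = card A" "length ys = card B" using xs ys distinct_card by fastforce+
  then obtain a b r where abr: "xs = a # b # r"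
    using assms(4) by (cases xs; cases "tl xs") auto
  let ?r = "r @ ys"
  have d: "a \<noteq> b" "a \<notin> set ?r" "b \<notin> set ?r" "distinct ?r"
    using xs ys abr assms(3) by auto
  have ab: "list_sign (a # b # ?r)
      = (-1) ^ (card {y\<in>set (b # ?r). y < a} + card {y\<in>set ?r. y < b}) * list_sign ?r"
    using d list_sign_Cons [of a "b # ?r"] list_sign_Cons [of b ?r]
    by (simp add: power_add mult.assoc del: set_append)
  have ba: "list_sign (b # a # ?r)
      = (-1) ^ (card {y\<in>set (a # ?r). y < b} + card {y\<in>set ?r. y < a}) * list_sign ?r"
    using d list_sign_Cons [of b "a # ?r"] list_sign_Cons [of a ?r]
    by (simp add: power_add mult.assoc del: set_append)
  have aux: "card {y\<in>set (u # ?r). y < v} = (if u < v then 1 else 0) + card {y\<in>set ?r. y < v}"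
    if "u \<notin> set ?r" for u v
  proof -
    have "{y\<in>set (u # ?r). y < v} = (if u < v then insert u {y\<in>set ?r. y < v} else {y\<in>set ?r. y < v})"
      by auto
    then show ?thesis using that by simp
  qed
  \<comment> \<open>Exactly one of the two orders has an inversion between \<open>a\<close> and
    \<open>b\<close>; the counts against \<open>?r\<close> agree.\<close>
  have neg: "list_sign (b # a # ?r) = - list_sign (a # b # ?r)"
    unfolding ab ba aux [OF d(2)] aux [OF d(3)] using d(1) by (auto simp: power_add)
  define vs where "vs = (if list_sign (a # b # ?r) = s then xs @ ys else (b # a # r) @ ys)"
  have "list_sign vs = s"
    using neg list_sign_cases [of "a # b # ?r"] assms(5) abr by (auto simp: vs_def)
  moreover have "take (card A) vs = (if list_sign (a # b # ?r) = s then xs else b # a # r)"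
    "drop (card A) vs = ys"
    unfolding len(1) [symmetric] by (simp_all add: vs_def abr)
  moreover have "distinct vs" "length vs = card A + card B"
    using d xs ys len abr by (auto simp: vs_def)
  ultimately show ?thesis using xs ys abr by (intro exI [of _ vs]) auto
qed

section \<open>Vertex signs and the boundary of a boundary\<close>

lemma vertex_sign_remove:
  assumes "finite V" "j \<in> V" "k \<in> V" "j < k"
  shows "vertex_sign (V - {j}) k = - vertex_sign V k" "vertex_sign (V - {k}) j = vertex_sign V j"
proof -
  have "{u\<in>V. u < k} = insert j {u\<in>V - {j}. u < k}" using assms by auto
  then have "vertex_index V k = Suc (vertex_index (V - {j}) k)"
    using assms(1) by (simp add: vertex_index_def)
  then show "vertex_sign (V - {j}) k = - vertex_sign V k" by (simp add: vertex_sign_def)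
  have "{u\<in>V. u < j} = {u\<in>V - {k}. u < j}" using assms by auto
  then show "vertex_sign (V - {k}) j = vertex_sign V j"
    by (simp add: vertex_sign_def vertex_index_def)
qed

text \<open>Deleting the smaller vertex lowers the rank of the larger one by one, while deleting the
  larger does not affect the smaller; so the two orders of deletion carry opposite signs.\<close>

lemma vertex_sign_remove_cancel:
  assumes "finite V" "j \<in> V" "k \<in> V" "j \<noteq> k"
  shows "vertex_sign V j * vertex_sign (V - {j}) k + vertex_sign V k * vertex_sign (V - {k}) j = 0"
  using vertex_sign_remove [OF assms(1-3)] vertex_sign_remove [OF assms(1,3,2)] assms(4)
  by (cases j k rule: linorder_cases) auto

lemma boundary_coeff_remove:
  assumes "finite V" "j \<in> V" "k \<in> V" "j \<noteq> k"
  shows "boundary_coeff 1 (V - {j}) (V - {j, k}) = vertex_sign (V - {j}) k"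
proof -
  have "V - {j} - (V - {j, k}) = {k}" using assms by auto
  then show ?thesis by (auto simp: boundary_coeff_def vertex_sign_def)
qed

text \<open>A face that misses two vertices arises from two orders of deletion, with opposite signs;
  for any other \<open>f\<close> every coefficient is zero.\<close>

lemma double_boundary:
  assumes "finite V"
  shows "(\<Sum>v\<in>V. vertex_sign V v * boundary_coeff 1 (V - {v}) f) = 0"
proof (cases "\<exists>j\<in>V. \<exists>k\<in>V. j \<noteq> k \<and> f = V - {j, k}")
  case True
  then obtain j k where jk: "j \<in> V" "k \<in> V" "j \<noteq> k" "f = V - {j, k}" by blast
  have "boundary_coeff 1 (V - {v}) f = 0" if "v \<in> V - {j, k}" for v
    using that jk by (auto simp: boundary_coeff_def)
  then have "(\<Sum>v\<in>V. vertex_sign V v * boundary_coeff 1 (V - {v}) f)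
      = (\<Sum>v\<in>{j, k}. vertex_sign V v * boundary_coeff 1 (V - {v}) f)"
    by (intro sum.mono_neutral_right) (use assms jk in auto)
  also have "\<dots> = vertex_sign V j * vertex_sign (V - {j}) k + vertex_sign V k * vertex_sign (V - {k}) j"
    using boundary_coeff_remove [OF assms jk(1-3)] boundary_coeff_remove [OF assms jk(2,1)] jk
    by (simp add: insert_commute)
  finally show ?thesis using vertex_sign_remove_cancel [OF assms jk(1-3)] by simp
next
  case False
  have "boundary_coeff 1 (V - {v}) f = 0" if v: "v \<in> V" for v
  proof (rule ccontr)
    assume "boundary_coeff 1 (V - {v}) f \<noteq> 0"
    then have "f \<subseteq> V - {v}" "card (V - {v} - f) = 1"
      by (auto simp: boundary_coeff_def split: if_splits)
    moreover then obtain k where "V - {v} - f = {k}" using card_1_singletonE by blast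
    ultimately have "k \<in> V" "k \<noteq> v" "f = V - {v, k}" by auto
    then show False using False v by blast
  qed
  then show ?thesis by simp
qed

section \<open>Reversibility of moves\<close>

text \<open>This is the combinatorial invariant carried along moves. The cycle condition ranges over
  all sets \<open>f\<close>, so that the sums of two complexes can be compared at an
  \<open>f\<close> lying in only one of them.\<close>

definition cycle_orientation :: "nat \<Rightarrow> oriented_complex \<Rightarrow> bool" where
  "cycle_orientation n L \<longleftrightarrow> finite (fst L) \<and> down_closed (fst L) \<and>
     (\<forall>F. F \<notin> simplices n (fst L) \<longrightarrow> snd L F = 0) \<and>
     (\<forall>f. (\<Sum>F\<in>simplices n (fst L). snd L F * boundary_coeff 1 F f) = 0)"

text \<open>A set \<open>f\<close> with a nonzero coefficient is a face with \<open>n\<close>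
  vertices of some top simplex, hence nonempty and in the complex, where the manifold condition
  applies. For other \<open>f\<close> every summand vanishes.\<close>

lemma triangulated_manifold_cycle_orientation:
  assumes "K \<in> triangulated_manifolds n" "n \<ge> 1"
  shows "cycle_orientation n K"
proof -
  have sc: "simplicial_complex (fst K)" and zero: "\<forall>F. F \<notin> simplices n (fst K) \<longrightarrow> snd K F = 0"
    and cyc: "\<forall>f\<in>simplices (n - 1) (fst K).
      (\<Sum>F\<in>simplices n (fst K). snd K F * boundary_coeff 1 F f) = 0"
    using assms(1) by (cases K; simp add: triangulated_manifolds_def)+
  have fin: "finite (fst K)" and sub: "\<And>s t. s \<in> fst K \<Longrightarrow> t \<subseteq> s \<Longrightarrow> t \<noteq> {} \<Longrightarrow> t \<in> fst K"
    and fin': "\<And>s. s \<in> fst K \<Longrightarrow> finite s"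
    using sc unfolding simplicial_complex_def by blast+
  have "(\<Sum>F\<in>simplices n (fst K). snd K F * boundary_coeff 1 F f) = 0" for f
  proof (cases "\<exists>F\<in>simplices n (fst K). boundary_coeff 1 F f \<noteq> 0")
    case True
    then obtain F where F: "F \<in> fst K" "card F = n + 1" "f \<subseteq> F" "card (F - f) = 1"
      by (auto simp: simplices_def boundary_coeff_def split: if_splits)
    then have "card f = n" using fin' [OF F(1)] card_Diff_subset [of f F] finite_subset [of f F]
        card_mono [of F f] by fastforce
    moreover from this have "f \<noteq> {}" using assms(2) by auto
    ultimately have "f \<in> simplices (n - 1) (fst K)"
      using sub [OF F(1,3)] assms(2) by (auto simp: simplices_def)
    then show ?thesis using cyc by blast
  next
    case False
    then show ?thesis by (intro sum.neutral) simp
  qed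
  then show ?thesis
    using fin sub zero unfolding cycle_orientation_def down_closed_def by blast
qed

text \<open>The fundamental chains of \<open>L'\<close> and \<open>L\<close> differ by \<open>s \<partial>(\<alpha> \<union> \<beta>)\<close>.  Unlike a positive listing, this
  description is symmetric: the inverse move has sign \<open>-s\<close>.\<close>

definition signed_move :: "nat \<Rightarrow> oriented_complex \<Rightarrow> face \<Rightarrow> face \<Rightarrow> oriented_complex \<Rightarrow> int \<Rightarrow> bool" where
  "signed_move h L \<alpha> \<beta> L' s \<longleftrightarrow> (s = 1 \<or> s = -1) \<and>
     (\<forall>v\<in>\<alpha>. snd L' (\<alpha> \<union> \<beta> - {v}) = s * vertex_sign (\<alpha> \<union> \<beta>) v) \<and>
     (\<forall>v\<in>\<beta>. snd L (\<alpha> \<union> \<beta> - {v}) = - s * vertex_sign (\<alpha> \<union> \<beta>) v)"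

text \<open>No simplex of \<open>K\<close> contains \<beta>, so every simplex of \<open>L\<close>
  containing \<beta> was inserted by the move; this determines the link of \<beta> in
  \<open>L\<close>.\<close>

lemma bistellar_pair_reverse:
  assumes bp: "bistellar_pair h K \<alpha> \<beta>" and disj: "\<alpha> \<inter> \<beta> = {}" and dc: "down_closed K"
    and L: "L = (K - join_boundary \<alpha> \<beta>) \<union> join_boundary \<beta> \<alpha>"
  shows "bistellar_pair h L \<beta> \<alpha>" "K = (L - join_boundary \<beta> \<alpha>) \<union> join_boundary \<alpha> \<beta>"
proof -
  have \<alpha>: "\<alpha> \<in> K" "card \<alpha> = h + 1" "\<alpha> \<noteq> {}" and \<beta>: "\<beta> \<notin> K" "card \<beta> = h + 1" "\<beta> \<noteq> {}"
    using bp by (auto simp: bistellar_pair_def simplices_def)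
  have no\<beta>: "t \<notin> K" if "\<beta> \<subseteq> t" for t
    using dc \<beta> that unfolding down_closed_def by blast
  have jsub: "join_boundary \<alpha> \<beta> \<subseteq> K" by (rule join_boundary_in_complex [OF bp dc])
  have \<beta>L: "\<beta> \<in> L"
    unfolding L by (intro UnI2 join_boundaryI [of _ \<beta> "{}"]) (use \<alpha> \<beta> in auto)
  have \<alpha>n: "\<alpha> \<notin> join_boundary \<beta> \<alpha>"
  proof
    assume "\<alpha> \<in> join_boundary \<beta> \<alpha>"
    then obtain a b where "\<alpha> = a \<union> b" "a \<subseteq> \<beta>" "b \<subset> \<alpha>" unfolding join_boundary_def by blast
    then show False using disj by blast
  qed
  have "\<alpha> \<in> join_boundary \<alpha> \<beta>"
    by (rule join_boundaryI [of _ \<alpha> "{}"]) (use \<alpha> \<beta> in auto)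
  then have \<alpha>L: "\<alpha> \<notin> L" unfolding L using \<alpha>n by blast
  have "link L \<beta> = simplex_boundary \<alpha>"
  proof (intro equalityI subsetI)
    fix t assume "t \<in> link L \<beta>"
    then have t: "t \<noteq> {}" "t \<inter> \<beta> = {}" "t \<union> \<beta> \<in> L" by (auto simp: link_def)
    then have "t \<union> \<beta> \<in> join_boundary \<beta> \<alpha>" using no\<beta> [of "t \<union> \<beta>"] unfolding L by blast
    then obtain a b where "t \<union> \<beta> = a \<union> b" "a \<subseteq> \<beta>" "b \<subset> \<alpha>" unfolding join_boundary_def by blast
    then have "t \<subset> \<alpha>" using t(2) disj by blast
    then show "t \<in> simplex_boundary \<alpha>" using t by (simp add: simplex_boundary_def)
  next
    fix t assume "t \<in> simplex_boundary \<alpha>"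
    then have t: "t \<noteq> {}" "t \<subset> \<alpha>" by (auto simp: simplex_boundary_def)
    have "t \<union> \<beta> \<in> L"
      unfolding L by (intro UnI2 join_boundaryI [of _ \<beta> t]) (use t in auto)
    then show "t \<in> link L \<beta>" using t disj by (auto simp: link_def)
  qed
  then show "bistellar_pair h L \<beta> \<alpha>"
    using \<alpha> \<beta> \<beta>L \<alpha>L by (auto simp: bistellar_pair_def simplices_def)
  \<comment> \<open>Inserted simplices that were already in \<open>K\<close> lie in the join of the
    two boundaries, hence among those that the inverse move puts back.\<close>
  have "x \<in> join_boundary \<alpha> \<beta>" if x: "x \<in> K" "x \<in> join_boundary \<beta> \<alpha>" for x
  proof -
    obtain a b where ab: "x = a \<union> b" "a \<subseteq> \<beta>" "b \<subset> \<alpha>" "x \<noteq> {}"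
      using x(2) unfolding join_boundary_def by blast
    moreover have "a \<noteq> \<beta>" using ab no\<beta> [of x] x(1) by blast
    ultimately show ?thesis by (intro join_boundaryI [of x b a]) auto
  qed
  then show "K = (L - join_boundary \<beta> \<alpha>) \<union> join_boundary \<alpha> \<beta>"
    using jsub unfolding L by blast
qed

text \<open>The top simplices of both balls arise from \<alpha> \<union> \<beta> by deleting one
  vertex: a vertex of \<beta> for the old ones, a vertex of \<alpha> for the new ones. All other top
  simplices are common to \<open>L\<close> and \<open>L'\<close>.\<close>

lemma move_basics:
  assumes mv: "bistellar_move h L \<alpha> \<beta> L'" and dc: "down_closed (fst L)"
  shows "finite (\<alpha> \<union> \<beta>)" "card (\<alpha> \<union> \<beta>) = 2 * h + 2" "\<alpha> \<inter> \<beta> = {}" "card \<alpha> = h + 1" "card \<beta> = h + 1"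
    and "v \<in> \<alpha> \<Longrightarrow> \<alpha> \<union> \<beta> - {v} \<in> simplices (2 * h) (fst L') - simplices (2 * h) (fst L)"
    and "v \<in> \<beta> \<Longrightarrow> \<alpha> \<union> \<beta> - {v} \<in> simplices (2 * h) (fst L) - simplices (2 * h) (fst L')"
    and "(\<And>v. v \<in> \<alpha> \<union> \<beta> \<Longrightarrow> F \<noteq> \<alpha> \<union> \<beta> - {v}) \<Longrightarrow>
      F \<in> simplices (2 * h) (fst L') \<longleftrightarrow> F \<in> simplices (2 * h) (fst L)"
proof -
  have bp: "bistellar_pair h (fst L) \<alpha> \<beta>"
    and L': "fst L' = (fst L - join_boundary \<alpha> \<beta>) \<union> join_boundary \<beta> \<alpha>"
    using mv by (auto simp: bistellar_move_def)
  show c: "card \<alpha> = h + 1" "card \<beta> = h + 1"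
    using bp by (auto simp: bistellar_pair_def simplices_def)
  then have f: "finite \<alpha>" "finite \<beta>" and ne: "\<alpha> \<noteq> {}" "\<beta> \<noteq> {}"
    using card.infinite by fastforce+
  obtain vs where "positive_listing h L \<alpha> \<beta> vs" using mv by (auto simp: bistellar_move_def)
  then have vs: "distinct vs" "set (take (h + 1) vs) = \<alpha>" "set (drop (h + 1) vs) = \<beta>"
    by (auto simp: positive_listing_def)
  show disj: "\<alpha> \<inter> \<beta> = {}"
    unfolding vs(2,3) [symmetric] by (rule set_take_disj_set_drop_if_distinct) (use vs in auto)
  show fV: "finite (\<alpha> \<union> \<beta>)" and cV: "card (\<alpha> \<union> \<beta>) = 2 * h + 2"
    using f c disj by (auto simp: card_Un_disjoint)
  have c1: "card (\<alpha> \<union> \<beta> - {v}) = 2 * h + 1" if "v \<in> \<alpha> \<union> \<beta>" for v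
    using that fV cV by (metis Suc_eq_plus1 Suc_1 add_Suc_right card_Diff_singleton diff_Suc_1)
  note rev = bistellar_pair_reverse [OF bp disj dc L']
  have dc': "down_closed (fst L')" by (rule down_closed_move [OF mv dc])
  have no\<beta>: "t \<notin> fst L" if "\<beta> \<subseteq> t" for t
    using dc bp that unfolding down_closed_def bistellar_pair_def
    by (metis c(2) card.empty add_is_0 zero_neq_one)
  have no\<alpha>: "t \<notin> fst L'" if "\<alpha> \<subseteq> t" for t
    using dc' rev(1) that unfolding down_closed_def bistellar_pair_def
    by (metis c(1) card.empty add_is_0 zero_neq_one)
  show "\<alpha> \<union> \<beta> - {v} \<in> simplices (2 * h) (fst L') - simplices (2 * h) (fst L)" if v: "v \<in> \<alpha>"
  proof -
    have "\<alpha> \<union> \<beta> - {v} \<in> join_boundary \<beta> \<alpha>"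
      by (rule join_boundaryI [of _ \<beta> "\<alpha> - {v}"]) (use v disj ne in auto)
    then show ?thesis using no\<beta> [of "\<alpha> \<union> \<beta> - {v}"] c1 [of v] v disj L' by (auto simp: simplices_def)
  qed
  show "\<alpha> \<union> \<beta> - {v} \<in> simplices (2 * h) (fst L) - simplices (2 * h) (fst L')" if v: "v \<in> \<beta>"
  proof -
    have "\<alpha> \<union> \<beta> - {v} \<in> join_boundary \<alpha> \<beta>"
      by (rule join_boundaryI [of _ \<alpha> "\<beta> - {v}"]) (use v disj ne in auto)
    then show ?thesis using no\<alpha> [of "\<alpha> \<union> \<beta> - {v}"] c1 [of v] v disj
      join_boundary_in_complex [OF bp dc] by (auto simp: simplices_def)
  qed
  assume F: "\<And>v. v \<in> \<alpha> \<union> \<beta> \<Longrightarrow> F \<noteq> \<alpha> \<union> \<beta> - {v}"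
  have "\<not> F \<subseteq> \<alpha> \<union> \<beta>" if "card F = 2 * h + 1"
  proof
    assume s: "F \<subseteq> \<alpha> \<union> \<beta>"
    then have "card (\<alpha> \<union> \<beta> - F) = 1"
      using card_Diff_subset [OF finite_subset [OF s fV] s] that cV by simp
    then obtain v where "\<alpha> \<union> \<beta> - F = {v}" using card_1_singletonE by blast
    then show False using F [of v] s by blast
  qed
  then have "F \<notin> join_boundary \<alpha> \<beta>" "F \<notin> join_boundary \<beta> \<alpha>" if "card F = 2 * h + 1"
    using that unfolding join_boundary_def by blast+
  then show "F \<in> simplices (2 * h) (fst L') \<longleftrightarrow> F \<in> simplices (2 * h) (fst L)"
    using L' by (auto simp: simplices_def)
qed

text \<open>The sign \<open>s\<close> is that of the whole listing. The move prescribes the signs of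
  all new simplices but of only one old simplex; the cycle condition on \<open>L\<close> yields the
  remaining ones.\<close>

lemma move_signed:
  assumes h: "h \<ge> 1" and mv: "bistellar_move h L \<alpha> \<beta> L'" and cyc: "cycle_orientation (2 * h) L"
  shows "\<exists>s. signed_move h L \<alpha> \<beta> L' s"
proof -
  let ?V = "\<alpha> \<union> \<beta>"
  have dc: "down_closed (fst L)" and fin: "finite (fst L)"
    using cyc by (auto simp: cycle_orientation_def)
  note mb = move_basics [OF mv dc]
  have bp: "bistellar_pair h (fst L) \<alpha> \<beta>" using mv by (auto simp: bistellar_move_def)
  obtain vs where pl: "positive_listing h L \<alpha> \<beta> vs" and new: "\<forall>i\<le>h. snd L' (set vs - {vs ! i}) =
           (-1) ^ i * list_sign (take i vs @ drop (i + 1) vs)"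
    using mv by (auto simp: bistellar_move_def)
  have vs: "distinct vs" "length vs = 2 * h + 2" "set (take (h + 1) vs) = \<alpha>" "set (drop (h + 1) vs) = \<beta>"
    and pos: "snd L (set (take (2 * h + 1) vs)) = list_sign (take (2 * h + 1) vs)"
    using pl by (auto simp: positive_listing_def)
  have V: "set vs = ?V" using vs(3,4) by (metis append_take_drop_id set_append)
  define s where "s = list_sign vs"
  have s: "s = 1 \<or> s = -1" unfolding s_def by (rule list_sign_cases)
  have 1: "snd L' (?V - {v}) = s * vertex_sign ?V v" if v: "v \<in> \<alpha>" for v
  proof -
    obtain i where "i < length (take (h + 1) vs)" "take (h + 1) vs ! i = v"
      using v vs(3) by (metis in_set_conv_nth)
    then have "i \<le> h" "vs ! i = v" "i < length vs" using vs(2) by auto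
    then show ?thesis using new list_sign_remove_nth [OF vs(1), of i] V by (auto simp: s_def)
  qed
  let ?l = "vs ! (2 * h + 1)"
  have l\<beta>: "?l \<in> \<beta>"
    using vs(2,4) nth_mem [of h "drop (h + 1) vs"] by (simp add: mult_2)
  \<comment> \<open>The last entry stands at the odd position \<open>2 * h + 1\<close>; deleting it
    produces the minus sign.\<close>
  have lV: "snd L (?V - {?l}) = - s * vertex_sign ?V ?l"
  proof -
    have "vs = take (2 * h + 1) vs @ [?l]"
      using vs(2) id_take_nth_drop [of "2 * h + 1" vs] by simp
    then have "set (take (2 * h + 1) vs) = ?V - {?l}"
      using V vs(1) by (metis Diff_insert_absorb Un_insert_right distinct_append distinct.simps(2)
        list.simps(15) set_append empty_set sup_bot_right disjoint_insert(1))
    moreover have "take (2 * h + 1) vs @ drop (2 * h + 1 + 1) vs = take (2 * h + 1) vs"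
      using vs(2) by simp
    ultimately have "- snd L (?V - {?l}) = vertex_sign ?V ?l * s"
      using pos list_sign_remove_nth [OF vs(1), of "2 * h + 1"] vs(2) V by (simp add: s_def)
    then show ?thesis by (simp add: mult.commute minus_equation_iff [of "snd L _"])
  qed
  \<comment> \<open>Only two top simplices of \<open>L\<close> contain \<open>\<alpha> * (\<beta> \<setminus> {v, w})\<close>, so the cycle condition there
    carries the sign from the last vertex \<open>w\<close> of the listing to \<open>v\<close>.\<close>
  have 2: "snd L (?V - {v}) = - s * vertex_sign ?V v" if v: "v \<in> \<beta>" for v
  proof (cases "v = ?l")
    case True
    then show ?thesis using lV by simp
  next
    case False
    let ?f = "?V - {v, ?l}"
    have vl: "v \<in> ?V" "?l \<in> ?V" "v \<noteq> ?l" using v l\<beta> False by auto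
    have d: "?V - {v} \<noteq> ?V - {?l}" using vl by blast
    have in': "?V - {v} \<in> simplices (2 * h) (fst L)" "?V - {?l} \<in> simplices (2 * h) (fst L)"
      using mb(7) v l\<beta> by blast+
    have other: "boundary_coeff 1 F ?f = 0"
      if F: "F \<in> simplices (2 * h) (fst L) - {?V - {v}, ?V - {?l}}" for F
    proof (rule ccontr)
      assume "boundary_coeff 1 F ?f \<noteq> 0"
      then have sub: "?f \<subseteq> F" and "card (F - ?f) = 1"
        by (auto simp: boundary_coeff_def split: if_splits)
      then obtain w where w: "F - ?f = {w}" using card_1_singletonE by blast
      have \<alpha>F: "\<alpha> \<subseteq> F" using sub v l\<beta> mb(3) by blast
      \<comment> \<open>For \<open>h \<ge> 1\<close> a top simplex has more than
        \<open>h + 1\<close> vertices, so \<open>F - \<alpha>\<close> is nonempty, as membership in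
        the link requires.\<close>
      have "F \<noteq> \<alpha>" using F mb(4) h by (auto simp: simplices_def)
      then have "F - \<alpha> \<in> link (fst L) \<alpha>" using \<alpha>F F by (auto simp: link_def simplices_def Un_absorb2)
      then have "F - \<alpha> \<subset> \<beta>" using bp by (auto simp: bistellar_pair_def simplex_boundary_def)
      then have "w \<in> {v, ?l}" using w by blast
      moreover have "F = insert w ?f" using w sub by blast
      moreover have "insert v ?f = ?V - {?l}" "insert ?l ?f = ?V - {v}" using vl by auto
      ultimately have "F = ?V - {v} \<or> F = ?V - {?l}" by blast
      then show False using F by blast
    qed
    have "0 = (\<Sum>F\<in>simplices (2 * h) (fst L). snd L F * boundary_coeff 1 F ?f)"
      using cyc by (simp add: cycle_orientation_def)
    also have "\<dots> = (\<Sum>F\<in>{?V - {v}, ?V - {?l}}. snd L F * boundary_coeff 1 F ?f)"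
      by (intro sum.mono_neutral_right)
        (use in' other fin in \<open>auto simp: simplices_def\<close>)
    also have "\<dots> = snd L (?V - {v}) * vertex_sign (?V - {v}) ?l
        + snd L (?V - {?l}) * vertex_sign (?V - {?l}) v"
      using boundary_coeff_remove [OF mb(1) vl] boundary_coeff_remove [OF mb(1) vl(2,1)] vl d
      by (simp add: insert_commute)
    finally have "snd L (?V - {v}) * vertex_sign (?V - {v}) ?l
        = s * (vertex_sign ?V ?l * vertex_sign (?V - {?l}) v)"
      unfolding lV by simp
    also have "vertex_sign ?V ?l * vertex_sign (?V - {?l}) v = - (vertex_sign ?V v * vertex_sign (?V - {v}) ?l)"
      using vertex_sign_remove_cancel [OF mb(1) vl] by simp
    finally have "snd L (?V - {v}) * (vertex_sign (?V - {v}) ?l * vertex_sign (?V - {v}) ?l)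
        = - s * vertex_sign ?V v * (vertex_sign (?V - {v}) ?l * vertex_sign (?V - {v}) ?l)"
      by (simp only: mult.assoc [symmetric]) simp
    then show ?thesis by simp
  qed
  show ?thesis unfolding signed_move_def using s 1 2 by blast
qed

text \<open>The fundamental chain changes by a multiple of the boundary of \<alpha> \<union>
  \<beta>, and the boundary of that vanishes by \<open>double_boundary\<close>.\<close>

lemma cycle_orientation_move:
  assumes h: "h \<ge> 1" and mv: "bistellar_move h L \<alpha> \<beta> L'" and cyc: "cycle_orientation (2 * h) L"
  shows "cycle_orientation (2 * h) L'"
proof -
  let ?V = "\<alpha> \<union> \<beta>"
  let ?S = "simplices (2 * h) (fst L)" and ?S' = "simplices (2 * h) (fst L')"
  have dc: "down_closed (fst L)" and fin: "finite (fst L)" and zero: "\<And>F. F \<notin> ?S \<Longrightarrow> snd L F = 0"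
    using cyc by (auto simp: cycle_orientation_def)
  note mb = move_basics [OF mv dc]
  have same: "\<And>F. F \<in> ?S \<Longrightarrow> F \<in> ?S' \<Longrightarrow> snd L' F = snd L F"
    and zero': "\<And>F. F \<notin> ?S' \<Longrightarrow> snd L' F = 0"
    and L': "fst L' = (fst L - join_boundary \<alpha> \<beta>) \<union> join_boundary \<beta> \<alpha>"
    using mv by (auto simp: bistellar_move_def)
  obtain s where s: "signed_move h L \<alpha> \<beta> L' s" using move_signed [OF h mv cyc] by blast
  have "join_boundary \<beta> \<alpha> \<subseteq> Pow ?V" unfolding join_boundary_def by blast
  then have fin': "finite (fst L')" using fin mb(1) L' by (auto intro: finite_subset)
  have "(\<Sum>F\<in>?S'. snd L' F * boundary_coeff 1 F f) = 0" for f
  proof -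
    let ?U = "?S \<union> ?S'" and ?N = "(\<lambda>v. ?V - {v}) ` ?V"
    have fU: "finite ?U" using fin fin' by (simp add: simplices_def)
    have N: "?N \<subseteq> ?U" using mb(6,7) by blast
    have inj: "inj_on (\<lambda>v. ?V - {v}) ?V" by (intro inj_onI) blast
    \<comment> \<open>Each of these simplices lies in exactly one of the two complexes, and the
      other orientation is 0 there; the opposite signs in \<open>signed_move\<close> combine to one
      formula for all \<open>v\<close>.\<close>
    have diff: "snd L' (?V - {v}) - snd L (?V - {v}) = s * vertex_sign ?V v" if "v \<in> ?V" for v
      using that s mb(6,7) zero zero' unfolding signed_move_def by fastforce
    have same': "snd L' F - snd L F = 0" if "F \<notin> ?N" for F
      using mb(8) [of F] that same zero zero' by (cases "F \<in> ?S") auto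
    \<comment> \<open>Both orientations vanish outside their own complexes, so both sums may run
      over the union.\<close>
    have "(\<Sum>F\<in>?S'. snd L' F * boundary_coeff 1 F f) = (\<Sum>F\<in>?U. snd L' F * boundary_coeff 1 F f)"
      by (intro sum.mono_neutral_left fU) (auto simp: zero')
    moreover have "(\<Sum>F\<in>?S. snd L F * boundary_coeff 1 F f) = (\<Sum>F\<in>?U. snd L F * boundary_coeff 1 F f)"
      by (intro sum.mono_neutral_left fU) (auto simp: zero)
    moreover have "(\<Sum>F\<in>?S. snd L F * boundary_coeff 1 F f) = 0"
      using cyc by (simp add: cycle_orientation_def)
    moreover have "(\<Sum>F\<in>?U. (snd L' F - snd L F) * boundary_coeff 1 F f) = 0"
    proof -
      have "(\<Sum>F\<in>?U. (snd L' F - snd L F) * boundary_coeff 1 F f)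
          = (\<Sum>F\<in>?N. (snd L' F - snd L F) * boundary_coeff 1 F f)"
        by (intro sum.mono_neutral_right fU N) (use same' in auto)
      also have "\<dots> = (\<Sum>v\<in>?V. s * (vertex_sign ?V v * boundary_coeff 1 (?V - {v}) f))"
        by (subst sum.reindex [OF inj]) (auto intro!: sum.cong simp: diff)
      also have "\<dots> = 0" by (simp only: sum_distrib_left [symmetric] double_boundary [OF mb(1)] mult_zero_right)
      finally show ?thesis .
    qed
    ultimately show ?thesis by (simp add: left_diff_distrib sum_subtractf)
  qed
  then show ?thesis
    using fin' down_closed_move [OF mv dc] zero' unfolding cycle_orientation_def by blast
qed

text \<open>Exchanging the roles of the two complexes and of \<alpha> and \<beta> turns
  \<open>s\<close> into \<open>-s\<close> in \<open>signed_move\<close>. Hence a listing of \<beta>,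
  then \<alpha>, with sign \<open>-s\<close> is positive for \<open>L'\<close> and reproduces the
  orientation of \<open>L\<close>.\<close>

lemma bistellar_move_reverse:
  assumes h: "h \<ge> 1" and mv: "bistellar_move h L \<alpha> \<beta> L'" and cyc: "cycle_orientation (2 * h) L"
  shows "bistellar_move h L' \<beta> \<alpha> L"
proof -
  let ?V = "\<alpha> \<union> \<beta>"
  have dc: "down_closed (fst L)" using cyc by (auto simp: cycle_orientation_def)
  note mb = move_basics [OF mv dc]
  have bp: "bistellar_pair h (fst L) \<alpha> \<beta>"
    and L': "fst L' = (fst L - join_boundary \<alpha> \<beta>) \<union> join_boundary \<beta> \<alpha>"
    and same: "\<forall>F\<in>simplices (2 * h) (fst L) \<inter> simplices (2 * h) (fst L'). snd L' F = snd L F"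
    using mv by (auto simp: bistellar_move_def)
  obtain s where s: "signed_move h L \<alpha> \<beta> L' s" using move_signed [OF h mv cyc] by blast
  \<comment> \<open>Since \<open>h \<ge> 1\<close>, the simplex \<beta> has two vertices to
    exchange, so the sign \<open>-s\<close> is attained.\<close>
  have "\<exists>vs. distinct vs \<and> length vs = card \<beta> + card \<alpha> \<and> set (take (card \<beta>) vs) = \<beta> \<and>
      set (drop (card \<beta>) vs) = \<alpha> \<and> list_sign vs = - s"
    by (rule exists_listing_with_sign) (use mb(1,3-5) h s in \<open>auto simp: signed_move_def\<close>)
  then obtain vs where vs: "distinct vs" "length vs = 2 * h + 2" "set (take (h + 1) vs) = \<beta>"
      "set (drop (h + 1) vs) = \<alpha>" "list_sign vs = - s"
    using mb(4,5) by auto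
  have V: "set vs = ?V" using vs(3,4) by (metis append_take_drop_id set_append sup_commute)
  let ?l = "vs ! (2 * h + 1)"
  have "?l \<in> \<alpha>" using vs(2,4) nth_mem [of h "drop (h + 1) vs"] by (simp add: mult_2)
  have "vs = take (2 * h + 1) vs @ [?l]"
    using vs(2) id_take_nth_drop [of "2 * h + 1" vs] by simp
  then have "set (take (2 * h + 1) vs) = ?V - {?l}"
    using V vs(1) by (metis Diff_insert_absorb Un_insert_right distinct_append distinct.simps(2)
      list.simps(15) set_append empty_set sup_bot_right disjoint_insert(1))
  moreover have "take (2 * h + 1) vs @ drop (2 * h + 1 + 1) vs = take (2 * h + 1) vs"
    using vs(2) by simp
  ultimately have "snd L' (set (take (2 * h + 1) vs)) = list_sign (take (2 * h + 1) vs)"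
    using list_sign_remove_nth [OF vs(1), of "2 * h + 1"] vs(2,5) V s \<open>?l \<in> \<alpha>\<close>
    by (simp add: signed_move_def)
  then have "positive_listing h L' \<beta> \<alpha> vs" using vs by (simp add: positive_listing_def)
  moreover have "snd L (set vs - {vs ! i}) = (-1) ^ i * list_sign (take i vs @ drop (i + 1) vs)"
    if "i \<le> h" for i
  proof -
    have "vs ! i \<in> \<beta>" using that vs(2,3) nth_mem [of i "take (h + 1) vs"] by simp
    then show ?thesis
      using list_sign_remove_nth [OF vs(1), of i] that vs(2,5) V s by (simp add: signed_move_def)
  qed
  ultimately show ?thesis
    using bistellar_pair_reverse [OF bp mb(3) dc L'] same cyc
    unfolding bistellar_move_def cycle_orientation_def by auto
qed

section \<open>Bistellar classes and their base complex\<close>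

lemma cycle_orientation_class:
  assumes "h \<ge> 1" "K \<in> triangulated_manifolds (2 * h)" "L \<in> bistellar_class h K"
  shows "cycle_orientation (2 * h) L"
proof -
  have "(\<lambda>T T'. \<exists>\<alpha> \<beta>. bistellar_move h T \<alpha> \<beta> T')\<^sup>*\<^sup>* K L"
    using assms(3) by (simp add: bistellar_class_def)
  then show ?thesis
  proof induction
    case base
    show ?case by (rule triangulated_manifold_cycle_orientation) (use assms in auto)
  next
    case (step T T')
    then show ?case using cycle_orientation_move assms(1) by blast
  qed
qed

text \<open>All complexes on a path from \<open>K\<close> satisfy the cycle condition, so each move
  on it can be reversed and reachability is symmetric.\<close>

lemma bistellar_class_eq:
  assumes "h \<ge> 1" "K \<in> triangulated_manifolds (2 * h)" "L \<in> bistellar_class h K"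
  shows "bistellar_class h L = bistellar_class h K"
proof -
  let ?R = "\<lambda>T T'. \<exists>\<alpha> \<beta>. bistellar_move h T \<alpha> \<beta> T'"
  have KL: "?R\<^sup>*\<^sup>* K L" using assms(3) by (simp add: bistellar_class_def)
  then have "?R\<^sup>*\<^sup>* L K"
  proof induction
    case (step T T')
    then have "cycle_orientation (2 * h) T"
      using cycle_orientation_class [OF assms(1,2)] by (simp add: bistellar_class_def)
    then have "?R T' T" using step.hyps(2) bistellar_move_reverse [OF assms(1)] by blast
    then show ?case using step.IH by (rule converse_rtranclp_into_rtranclp)
  qed simp
  with KL show ?thesis unfolding bistellar_class_def by (auto intro: rtranclp_trans)
qed

section \<open>Substitution in rational functions\<close>

lemma scalar_add: "scalar (a + b) = scalar a + scalar b"
  by (simp add: scalar_def single_add)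

lemma scalar_mult: "scalar (a * b) = scalar a * scalar b"
  by (simp add: scalar_def mult_single)

section \<open>Evaluation of monomials and polynomials\<close>

definition monomial_eval :: "(nat list \<Rightarrow> 'f::field) \<Rightarrow> monomial \<Rightarrow> 'f" where
  "monomial_eval t m = (\<Prod>v\<in>Poly_Mapping.keys m. t v ^ Poly_Mapping.lookup m v)"

lemma monomial_eval_superset:
  assumes "finite S" "Poly_Mapping.keys m \<subseteq> S"
  shows "monomial_eval t m = (\<Prod>v\<in>S. t v ^ Poly_Mapping.lookup m v)"
  unfolding monomial_eval_def
  by (rule prod.mono_neutral_left) (use assms in \<open>auto simp: in_keys_iff\<close>)

lemma monomial_eval_0 [simp]: "monomial_eval t 0 = 1"
  by (simp add: monomial_eval_def)

lemma monomial_eval_single [simp]: "monomial_eval t (Poly_Mapping.single v e) = t v ^ e"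
  by (simp add: monomial_eval_superset [of "{v}"])

lemma monomial_eval_add: "monomial_eval t (m + n) = monomial_eval t m * monomial_eval t n"
proof -
  let ?S = "Poly_Mapping.keys m \<union> Poly_Mapping.keys n"
  have "monomial_eval t (m + n) = (\<Prod>v\<in>?S. t v ^ Poly_Mapping.lookup (m + n) v)"
    using Poly_Mapping.keys_add [of m n] by (intro monomial_eval_superset) auto
  also have "\<dots> = monomial_eval t m * monomial_eval t n"
    by (simp add: monomial_eval_superset [of ?S] lookup_add power_add prod.distrib)
  finally show ?thesis .
qed

lemma poly_mapping_sum_singles:
  fixes q :: "'a \<Rightarrow>\<^sub>0 'b::comm_monoid_add"
  shows "q = (\<Sum>m\<in>Poly_Mapping.keys q. Poly_Mapping.single m (Poly_Mapping.lookup q m))"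
  by (rule poly_mapping_eqI) (auto simp: lookup_sum lookup_single when_def in_keys_iff)

lemma poly_mapping_single_add_induct [case_names single add]:
  fixes q :: "'a \<Rightarrow>\<^sub>0 'b::comm_monoid_add"
  assumes single: "\<And>m c. P (Poly_Mapping.single m c)" and add: "\<And>a b. P a \<Longrightarrow> P b \<Longrightarrow> P (a + b)"
  shows "P q"
proof -
  have "P (\<Sum>m\<in>S. Poly_Mapping.single m (Poly_Mapping.lookup q m))" if "finite S" for S
    using that
  proof induction
    case empty
    \<comment> \<open>The zero polynomial is a term with coefficient 0 at an arbitrary
      exponent.\<close>
    then show ?case using single [of undefined 0] by simp
  qed (auto intro: single add)
  then show ?thesis using poly_mapping_sum_singles [of q] by (metis finite_keys)
qed

definition poly_eval ::
  "(nat list \<Rightarrow> 'p::semifield ratfun) \<Rightarrow> (monomial \<Rightarrow>\<^sub>0 'p group_ring) \<Rightarrow> 'p ratfun" where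
  "poly_eval t q = (\<Sum>m\<in>Poly_Mapping.keys q. scalar (Poly_Mapping.lookup q m) * monomial_eval t m)"

lemma poly_eval_single [simp]: "poly_eval t (Poly_Mapping.single m c) = scalar c * monomial_eval t m"
  by (simp add: poly_eval_def)

lemma poly_eval_0 [simp]: "poly_eval t 0 = 0"
  by (simp add: poly_eval_def)

lemma poly_eval_add: "poly_eval t (a + b) = poly_eval t a + poly_eval t b"
  unfolding poly_eval_def
  by (rule setsum_keys_plus_distrib) (simp_all add: scalar_add distrib_right)

lemma poly_eval_mult: "poly_eval t (a * b) = poly_eval t a * poly_eval t b"
proof (induction a rule: poly_mapping_single_add_induct)
  case (single m c)
  show ?case
  proof (induction b rule: poly_mapping_single_add_induct)
    case (single n d)
    then show ?case by (simp add: mult_single scalar_mult monomial_eval_add)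
  qed (simp add: distrib_left poly_eval_add)
qed (simp add: distrib_right poly_eval_add)

lemma poly_eval_1: "poly_eval t 1 = 1"
  using poly_eval_single [of t 0 1] by simp

lemma Fract_one_add: "Fract (a + b) 1 = Fract a 1 + Fract b (1 :: 'a :: idom)"
  and Fract_one_mult: "Fract (a * b) 1 = Fract a 1 * Fract b (1 :: 'a :: idom)"
  by simp_all

lemma Fract_one_eq_0_iff: "Fract a 1 = 0 \<longleftrightarrow> a = (0 :: 'a :: idom)"
  by (simp add: Zero_fract_def eq_fract)

definition ratfun_endomorphism :: "('p::semifield ratfun \<Rightarrow> 'p ratfun) \<Rightarrow> bool" where
  "ratfun_endomorphism T \<longleftrightarrow> (\<forall>x y. T (x + y) = T x + T y \<and> T (x * y) = T x * T y) \<and>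
     (\<forall>c. T (scalar c) = scalar c)"

text \<open>The hypothesis says that \<open>t\<close>, extended multiplicatively, inverts itself on the variables.
  It makes the evaluation at \<open>t\<close> injective, so that it extends to fractions.\<close>

lemma involution_extension:
  fixes t :: "nat list \<Rightarrow> 'p::semifield ratfun"
  assumes t: "\<And>v. \<exists>a b. t v = Fract a b \<and> poly_eval t b \<noteq> 0 \<and>
    poly_eval t a = of_monomial (Poly_Mapping.single v 1) * poly_eval t b"
  shows "\<exists>T. ratfun_endomorphism T \<and> (\<forall>v. T (of_monomial (Poly_Mapping.single v 1)) = t v) \<and>
    (\<forall>x. T (T x) = x)"
proof -
  \<comment> \<open>\<open>Q y x\<close> anticipates \<open>T y = x\<close> before \<open>T\<close>
    exists: some fraction representing \<open>y\<close> evaluates to \<open>x\<close>, with nonzero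
    denominator.\<close>
  define Q where "Q y x \<longleftrightarrow> (\<exists>a b. y = Fract a b \<and> poly_eval t b \<noteq> 0 \<and> poly_eval t a = x * poly_eval t b)"
    for x y
  have nz: "b \<noteq> 0" if "poly_eval t b \<noteq> 0" for b using that by auto
  have Qadd: "Q (y + y') (x + x')" and Qmult: "Q (y * y') (x * x')" if Q: "Q y x" "Q y' x'" for x y x' y'
  proof -
    obtain a b a' b' where ab: "y = Fract a b" "poly_eval t b \<noteq> 0" "poly_eval t a = x * poly_eval t b"
      and ab': "y' = Fract a' b'" "poly_eval t b' \<noteq> 0" "poly_eval t a' = x' * poly_eval t b'"
      using Q unfolding Q_def by blast
    have "y + y' = Fract (a * b' + a' * b) (b * b')" using ab ab' nz by simp
    then show "Q (y + y') (x + x')"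
      unfolding Q_def by (intro exI conjI, assumption)
        (use ab ab' in \<open>simp_all add: poly_eval_add poly_eval_mult algebra_simps\<close>)
    have "y * y' = Fract (a * a') (b * b')" using ab ab' by simp
    then show "Q (y * y') (x * x')"
      unfolding Q_def by (intro exI conjI, assumption)
        (use ab ab' in \<open>simp_all add: poly_eval_mult\<close>)
  qed
  have Qscalar: "Q (scalar c) (scalar c)" for c
    unfolding Q_def
  proof (rule exI [of _ "Poly_Mapping.single 0 c"], rule exI [of _ 1], intro conjI)
    show "scalar c = Fract (Poly_Mapping.single 0 c) 1" by (rule scalar_def)
  qed (simp_all add: poly_eval_1)
  have Qpower: "Q (y ^ n) (x ^ n)" if "Q y x" for x y n
    using Qscalar [of 1] Qmult [OF that] by (induction n) auto
  have Qmonomial: "Q (monomial_eval t m) (of_monomial m)" for m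
  proof -
    have Qv: "Q (t v) (of_monomial (Poly_Mapping.single v 1))" for v
      using t [of v] unfolding Q_def .
    have om: "of_monomial (Poly_Mapping.single v e) = (of_monomial (Poly_Mapping.single v 1) ^ e :: 'p ratfun)"
      for v e
    proof (induction e)
      case (Suc e)
      have "Poly_Mapping.single v (Suc e) = Poly_Mapping.single v 1 + Poly_Mapping.single v e"
        by (simp flip: single_add)
      then show ?case using Suc by (simp add: of_monomial_add)
    qed simp
    show ?thesis
    proof (induction m rule: poly_mapping_single_add_induct)
      case (single v e)
      then show ?case using Qpower [OF Qv [of v], of e] by (simp add: om [of v e])
    next
      case (add a b)
      then show ?case using Qmult by (simp add: of_monomial_add monomial_eval_add)
    qed
  qed
  \<comment> \<open>Evaluating the value of \<open>q\<close> once more gives back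
    \<open>q\<close>.\<close>
  have Q: "Q (poly_eval t q) (Fract q 1)" for q
  proof (induction q rule: poly_mapping_single_add_induct)
    case (single m c)
    have "Fract (Poly_Mapping.single m c) 1 = scalar c * of_monomial m"
      by (simp add: scalar_def of_monomial_def mult_single)
    then show ?case using Qmult [OF Qscalar Qmonomial] by simp
  next
    case (add a b)
    then show ?case unfolding Fract_one_add poly_eval_add by (rule Qadd)
  qed
  \<comment> \<open>If \<open>q\<close> had value 0, a second evaluation would give both 0 and
    \<open>q\<close>. Hence nonzero denominators keep nonzero values.\<close>
  have inj: "poly_eval t q \<noteq> 0" if q: "q \<noteq> 0" for q
  proof
    assume "poly_eval t q = 0"
    then have "Q 0 (Fract q 1)" using Q [of q] by metis
    then obtain a b where ab: "0 = Fract a b" "poly_eval t b \<noteq> 0" "poly_eval t a = Fract q 1 * poly_eval t b"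
      unfolding Q_def by blast
    have "Fract a b = Fract 0 1" using ab(1) by (metis Zero_fract_def)
    then have "a = 0" using eq_fract(1) [OF nz [OF ab(2)], of 1 a 0] by simp
    then have "Fract q 1 = 0" using ab(2,3) by (metis mult_eq_0_iff poly_eval_0)
    then show False using q Fract_one_eq_0_iff by metis
  qed
  \<comment> \<open>The value is read off from an arbitrary representation; independence of the
    choice rests on \<open>inj\<close>.\<close>
  define T where "T x = (SOME y. \<exists>a b. b \<noteq> 0 \<and> x = Fract a b \<and> y = poly_eval t a / poly_eval t b)" for x
  have T: "T (Fract a b) = poly_eval t a / poly_eval t b" if b: "b \<noteq> 0" for a b
    unfolding T_def
  proof (rule some_equality)
    fix y assume "\<exists>a' b'. b' \<noteq> 0 \<and> Fract a b = Fract a' b' \<and> y = poly_eval t a' / poly_eval t b'"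
    then obtain a' b' where y: "b' \<noteq> 0" "Fract a b = Fract a' b'" "y = poly_eval t a' / poly_eval t b'"
      by blast
    then have "a * b' = a' * b" using b by (simp add: eq_fract)
    then have "poly_eval t a * poly_eval t b' = poly_eval t a' * poly_eval t b"
      by (metis poly_eval_mult)
    then show "y = poly_eval t a / poly_eval t b" using y inj b by (simp add: frac_eq_eq)
  qed (use b in blast)
  have Tadd: "T (x + y) = T x + T y" and Tmult: "T (x * y) = T x * T y" for x y
  proof -
    obtain a b c d where x: "x = Fract a b" "b \<noteq> 0" and y: "y = Fract c d" "d \<noteq> 0"
      by (metis Fract_cases)
    show "T (x + y) = T x + T y"
      using x y by (simp add: T poly_eval_add poly_eval_mult add_frac_eq inj)
    show "T (x * y) = T x * T y"
      using x y by (simp add: T poly_eval_mult)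
  qed
  have T1: "T (Fract q 1) = poly_eval t q" for q by (simp add: T poly_eval_1)
  have TQ: "T y = x" if "Q y x" for x y
    using that nz unfolding Q_def by (auto simp: T)
  have T0: "T 0 = 0" and T1': "T 1 = 1"
    using T1 [of 0] T1 [of 1] by (simp_all add: poly_eval_1 flip: Zero_fract_def One_fract_def)
  have "T (T x) = x" for x
  proof -
    obtain a b where x: "x = Fract a b" "b \<noteq> 0" by (metis Fract_cases)
    \<comment> \<open>Clearing the denominator reduces the claim to polynomials, where
      \<open>Q\<close> applies.\<close>
    have "T (T x) * Fract b 1 = T (T x) * T (poly_eval t b)" using TQ [OF Q] by simp
    also have "\<dots> = T (T x * poly_eval t b)" by (simp add: Tmult)
    also have "T x * poly_eval t b = poly_eval t a" using x inj by (simp add: T)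
    also have "T (poly_eval t a) = Fract a 1" by (rule TQ [OF Q])
    also have "\<dots> = x * Fract b 1" using x mult_fract_cancel [of b a 1] by (simp add: mult.commute)
    finally have "T (T x) * Fract b 1 = x * Fract b 1" .
    moreover have "Fract b 1 \<noteq> 0" using x(2) Fract_one_eq_0_iff by metis
    ultimately show ?thesis by (metis mult_right_cancel)
  qed
  moreover have "T (of_monomial (Poly_Mapping.single v 1)) = t v" for v
    by (simp add: of_monomial_def T1)
  moreover have "T (scalar c) = scalar c" for c by (simp add: scalar_def [of c] T1)
  ultimately show ?thesis unfolding ratfun_endomorphism_def using Tadd Tmult by blast
qed

text \<open>Negatives come from the scalar -1 and inverses from \<open>1 / y\<close>; division by 0
  has value 0, which is a scalar, so closure under \<open>/\<close> needs no side condition.\<close>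

definition scalar_subfield :: "'p::semifield ratfun set \<Rightarrow> bool" where
  "scalar_subfield S \<longleftrightarrow> (\<forall>c. scalar c \<in> S) \<and> (\<forall>x\<in>S. \<forall>y\<in>S. x + y \<in> S \<and> x * y \<in> S \<and> x / y \<in> S)"

lemma scalar_subfield_power: "scalar_subfield S \<Longrightarrow> x \<in> S \<Longrightarrow> x ^ n \<in> S"
  unfolding scalar_subfield_def by (induction n) (auto simp flip: scalar_1)

lemma scalar_subfield_prod: "scalar_subfield S \<Longrightarrow> (\<And>i. i \<in> I \<Longrightarrow> x i \<in> S) \<Longrightarrow> prod x I \<in> S"
  by (induction I rule: infinite_finite_induct) (auto simp: scalar_subfield_def simp flip: scalar_1)

lemma scalar_subfield_cluster_field: "scalar_subfield (cluster_field h L)"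
  by (simp add: scalar_subfield_def scalar_in_cluster_field cluster_field_quotient)

text \<open>The variables of an lcm occur in one of its arguments. The subfield is arbitrary because
  two kinds occur: cluster fields, and the field of fractions fixed by a substitution.\<close>

lemma exchange_rhs_in_subfield:
  fixes S :: "'p::semifield ratfun set"
  assumes S: "scalar_subfield S"
    and g: "\<And>g. g \<in> common_facets h \<alpha> \<beta> \<Longrightarrow> var g \<in> S \<and> var (\<sigma> L \<alpha> ` g) \<in> S"
  shows "exchange_rhs h \<sigma> p L \<alpha> \<beta> f \<in> S"
proof -
  note rules = S [unfolded scalar_subfield_def]
  have sv: "of_monomial (Poly_Mapping.single (sorted_list_of_set g) e) \<in> S" if "var g \<in> S" for g e
    using scalar_subfield_power [OF S that, of e]
    unfolding var_monomial_def [symmetric] of_monomial_var_monomial .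
  have D: "exchange_denominator h \<sigma> L \<alpha> \<beta> f \<in> S"
    unfolding exchange_denominator_def
    by (intro scalar_subfield_prod [OF S]) (use g rules scalar_subfield_power [OF S] in auto)
  have M: "of_monomial m \<in> S"
    if m: "\<And>v. v \<in> Poly_Mapping.keys m \<Longrightarrow> \<exists>g. var g \<in> S \<and> v = sorted_list_of_set g" for m
    unfolding arg_cong [OF poly_mapping_sum_singles [of m], of of_monomial] of_monomial_sum
    by (rule scalar_subfield_prod [OF S]) (use m sv in blast)
  have T: "exchange_term h \<sigma> q s L \<alpha> \<beta> f \<in> S" for q s
  proof -
    let ?c = "common_facets h \<alpha> \<beta>"
    let ?e = "\<lambda>g. nat (max (s * exchange_matrix h L f g) 0)"
    let ?a = "\<Sum>g\<in>?c. var_monomial g (?e g)" and ?b = "\<Sum>g\<in>?c. var_monomial (\<sigma> L \<alpha> ` g) (?e g)"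
    have "of_monomial (lcm_monomial ?a ?b) \<in> S"
    proof (rule M)
      fix v assume "v \<in> Poly_Mapping.keys (lcm_monomial ?a ?b)"
      then have "v \<in> Poly_Mapping.keys ?a \<or> v \<in> Poly_Mapping.keys ?b"
        by (auto simp: in_keys_iff lcm_monomial.rep_eq max_def split: if_splits)
      then obtain g where "g \<in> ?c" "v = sorted_list_of_set g \<or> v = sorted_list_of_set (\<sigma> L \<alpha> ` g)"
        using keys_sum [of "\<lambda>g. var_monomial g (?e g)" ?c]
          keys_sum [of "\<lambda>g. var_monomial (\<sigma> L \<alpha> ` g) (?e g)" ?c]
        by (fastforce simp: var_monomial_def split: if_splits)
      then show "\<exists>g. var g \<in> S \<and> v = sorted_list_of_set g" using g by blast
    qed
    then show ?thesis unfolding exchange_term_def semifield_scalar_def using rules D by blast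
  qed
  show ?thesis unfolding exchange_rhs_def using rules T by blast
qed

text \<open>Over the common denominator the numerator is a sum of two terms with integer coefficient
  1. They cannot cancel: if they coincide, the coefficient is 2.\<close>

lemma exchange_rhs_nonzero:
  fixes p :: "'p::semifield seeds"
  shows "exchange_rhs h \<sigma> p L \<alpha> \<beta> f \<noteq> 0"
proof -
  have D: "exchange_denominator h \<sigma> L \<alpha> \<beta> f \<noteq> (0 :: 'p ratfun)"
  proof -
    have "(\<Prod>g\<in>I. var g ^ a g * var (s g) ^ b g) \<noteq> (0 :: 'p ratfun)" for I a b and s :: "face \<Rightarrow> face"
      by (induction I rule: infinite_finite_induct) auto
    then show ?thesis unfolding exchange_denominator_def .
  qed
  have nz: "semifield_scalar a * of_monomial m + semifield_scalar b * of_monomial n \<noteq> 0"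
    for a b :: 'p and m n
  proof -
    let ?q = "Poly_Mapping.single m (Poly_Mapping.single (to_additive a) (1::int))
      + Poly_Mapping.single n (Poly_Mapping.single (to_additive b) 1)"
    have "semifield_scalar a * of_monomial m + semifield_scalar b * of_monomial n = Fract ?q 1"
      by (simp add: semifield_scalar_def scalar_def of_monomial_def mult_single)
    moreover have "Poly_Mapping.lookup (Poly_Mapping.lookup ?q m) (to_additive a) \<noteq> 0"
      by (auto simp: lookup_add lookup_single when_def)
    then have "?q \<noteq> 0" by (metis lookup_zero)
    ultimately show ?thesis by (simp add: Fract_one_eq_0_iff)
  qed
  have eq: "a / d * x + b / d * y = (a * x + b * y) / d" for a b d x y :: "'p ratfun"
    by (simp add: add_divide_distrib)
  show ?thesis
    unfolding exchange_rhs_def exchange_term_def eq divide_eq_0_iff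
    by (simp only: nz D simp_thms)
qed

text \<open>Since \<open>R\<close> involves only variables outside \<open>E\<close>, the substitution
  \<open>x\<^sub>f \<mapsto> R\<^sub>f / x\<^sub>s\<^sub>f\<close> \<open>(f \<in> E)\<close> is its own inverse.\<close>

lemma swap_automorphism:
  fixes R :: "face \<Rightarrow> 'p::semifield ratfun"
  assumes E: "\<And>f. f \<in> E \<Longrightarrow> finite f \<and> s f \<in> E \<and> s (s f) = f"
    and R: "\<And>f. f \<in> E \<Longrightarrow> R f \<noteq> 0 \<and> R (s f) = R f"
    and RS: "\<And>f S. f \<in> E \<Longrightarrow> scalar_subfield S \<Longrightarrow> (\<And>g. finite g \<Longrightarrow> g \<notin> E \<Longrightarrow> var g \<in> S) \<Longrightarrow> R f \<in> S"
  shows "\<exists>T. ratfun_endomorphism T \<and> (\<forall>x. T (T x) = x) \<and>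
    (\<forall>f\<in>E. T (var f) = R f / var (s f)) \<and> (\<forall>f. finite f \<longrightarrow> f \<notin> E \<longrightarrow> T (var f) = var f)"
proof -
  \<comment> \<open>Monomials are indexed by vertex lists, so variables are recovered as faces by \<open>set\<close>.\<close>
  define t :: "nat list \<Rightarrow> 'p ratfun" where "t v = (if v \<in> sorted_list_of_set ` E
    then R (set v) / var (s (set v)) else of_monomial (Poly_Mapping.single v 1))" for v
  have tE: "t (sorted_list_of_set f) = R f / var (s f)" if "f \<in> E" for f
    using that E by (simp add: t_def)
  have tN: "t (sorted_list_of_set f) = var f" if "finite f" "f \<notin> E" for f
  proof -
    have "sorted_list_of_set f \<notin> sorted_list_of_set ` E"
      using that E by (metis imageE set_sorted_list_of_set)
    then show ?thesis by (simp add: t_def var_def var_monomial_def)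
  qed
  have ev: "poly_eval t (Poly_Mapping.single (Poly_Mapping.single v 1) 1) = t v" for v
    by simp
  \<comment> \<open>\<open>S\<close> consists of the fractions with numerator and denominator fixed
    by the substitution; it contains the variables outside \<open>E\<close> and therefore each
    \<open>R f\<close>.\<close>
  define S where "S = {x. \<exists>a b. b \<noteq> 0 \<and> x = Fract a b \<and> poly_eval t a = Fract a 1 \<and> poly_eval t b = Fract b 1}"
  have SI: "Fract a b \<in> S" if "b \<noteq> 0" "poly_eval t a = Fract a 1" "poly_eval t b = Fract b 1" for a b
    using that unfolding S_def by blast
  have S: "scalar_subfield S"
    unfolding scalar_subfield_def
  proof (intro conjI allI ballI)
    fix c show "scalar c \<in> S"
      unfolding scalar_def by (rule SI) (simp_all add: poly_eval_1 scalar_def One_fract_def)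
  next
    fix x y assume "x \<in> S" "y \<in> S"
    then obtain a b c d where x: "b \<noteq> 0" "x = Fract a b" "poly_eval t a = Fract a 1" "poly_eval t b = Fract b 1"
      and y: "d \<noteq> 0" "y = Fract c d" "poly_eval t c = Fract c 1" "poly_eval t d = Fract d 1"
      unfolding S_def by blast
    have "Fract (a * d + c * b) (b * d) \<in> S" "Fract (a * c) (b * d) \<in> S"
      by (rule SI; use x y in \<open>simp add: poly_eval_add poly_eval_mult\<close>)+
    then show "x + y \<in> S" "x * y \<in> S" using x y by simp_all
    show "x / y \<in> S"
    proof (cases "c = 0")
      case True
      have "Fract 0 1 \<in> S" by (rule SI) (simp_all add: poly_eval_1 Zero_fract_def One_fract_def)
      then show ?thesis using x y True by (simp add: fract_collapse)
    next
      case False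
      have "Fract (a * d) (b * c) \<in> S"
        by (rule SI; use x y False in \<open>simp add: poly_eval_mult\<close>)
      then show ?thesis using x y by simp
    qed
  qed
  have varS: "var g \<in> S" if "finite g" "g \<notin> E" for g
    unfolding var_def of_monomial_def
    by (rule SI) (use ev tN [OF that] in \<open>simp_all add: poly_eval_1 var_def of_monomial_def var_monomial_def One_fract_def\<close>)
  have "\<exists>T. ratfun_endomorphism T \<and> (\<forall>v. T (of_monomial (Poly_Mapping.single v 1)) = t v) \<and>
    (\<forall>x. T (T x) = x)"
  proof (rule involution_extension)
    fix v
    show "\<exists>a b. t v = Fract a b \<and> poly_eval t b \<noteq> 0 \<and>
      poly_eval t a = of_monomial (Poly_Mapping.single v 1) * poly_eval t b"
    proof (cases "v \<in> sorted_list_of_set ` E")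
      case True
      then obtain f where f: "f \<in> E" "v = sorted_list_of_set f" by blast
      then have sf: "s f \<in> E" "s (s f) = f" using E by blast+
      \<comment> \<open>As \<open>R f\<close> is fixed, only the variable of \<open>s f\<close>
        changes in \<open>t v\<close>. It becomes \<open>R f / var f\<close>, so the quotient
        evaluates to \<open>var f\<close>.\<close>
      have "R f \<in> S" using RS [OF f(1) S] varS by blast
      then obtain A B where AB: "B \<noteq> 0" "R f = Fract A B" "poly_eval t A = Fract A 1"
        "poly_eval t B = Fract B 1"
        unfolding S_def by blast
      let ?X = "Poly_Mapping.single (Poly_Mapping.single (sorted_list_of_set (s f)) 1) 1"
      have X: "var (s f) = Fract ?X 1" by (simp add: var_def of_monomial_def var_monomial_def)
      have "t v = R f / var (s f)" using tE f by simp
      then have 1: "t v = Fract A (B * ?X)" unfolding AB(2) X by simp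
      have B: "poly_eval t (B * ?X) = Fract B 1 * (R f / var f)"
        unfolding poly_eval_mult ev tE [OF sf(1)] sf(2) AB(4) using R [OF f(1)] by simp
      have RB: "Fract B 1 * R f = Fract A 1"
        unfolding AB(2) using AB(1) mult_fract_cancel [of B A 1] by simp
      have v: "of_monomial (Poly_Mapping.single v 1) = var f"
        by (simp add: f(2) var_def var_monomial_def)
      have 2: "poly_eval t (B * ?X) \<noteq> 0" unfolding B using R [OF f(1)] AB(1) by (simp add: Fract_one_eq_0_iff)
      have 3: "poly_eval t A = of_monomial (Poly_Mapping.single v 1) * poly_eval t (B * ?X)"
        unfolding B AB(3) v RB [symmetric] by simp
      show ?thesis using 1 2 3 by blast
    next
      case False
      then have tv: "t v = of_monomial (Poly_Mapping.single v 1)" by (simp add: t_def)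
      show ?thesis
        by (rule exI [of _ "Poly_Mapping.single (Poly_Mapping.single v 1) 1"], rule exI [of _ 1], intro conjI)
          (simp_all only: ev poly_eval_1 tv mult_1_right of_monomial_def one_neq_zero not_False_eq_True)
    qed
  qed
  then obtain T where T: "ratfun_endomorphism T" "\<And>v. T (of_monomial (Poly_Mapping.single v 1)) = t v"
    "\<forall>x. T (T x) = x"
    by blast
  have "T (var f) = t (sorted_list_of_set f)" for f
    using T(2) by (simp add: var_def var_monomial_def)
  then show ?thesis using T(1,3) tE tN by (intro exI [of _ T]) simp
qed

section \<open>Isomorphisms along moves\<close>

lemma ratfun_endomorphism_divide:
  assumes "ratfun_endomorphism T" "y \<noteq> 0"
  shows "T (x / y) * T y = T x"
  using assms by (metis nonzero_eq_divide_eq ratfun_endomorphism_def)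

text \<open>An involution is injective, so denominators stay nonzero and quotients of generated
  elements are mapped to quotients in \<open>S\<close>.\<close>

lemma ratfun_endomorphism_cluster_field:
  assumes T: "ratfun_endomorphism T" "\<And>x. T (T x) = x" and S: "scalar_subfield S"
    and var: "\<And>f. f \<in> facets h L \<Longrightarrow> T (var f) \<in> S" and z: "z \<in> cluster_field h L"
  shows "T z \<in> S"
proof -
  have A: "T x \<in> S" if "x \<in> subalgebra_generated scalar (cluster h L)" for x
    using that
  proof induction
    case (gen x)
    then show ?case using var by (auto simp: cluster_def)
  qed (use T(1) S in \<open>auto simp: ratfun_endomorphism_def scalar_subfield_def\<close>)
  have T0: "T 0 = 0" using T(1) by (metis ratfun_endomorphism_def scalar_0)
  obtain a b where ab: "z = a / b" "a \<in> subalgebra_generated scalar (cluster h L)"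
    "b \<in> subalgebra_generated scalar (cluster h L)" "b \<noteq> 0"
    using z unfolding cluster_field_def by blast
  have "T b \<noteq> 0" using ab(4) T(2) T0 by metis
  moreover have "T z * T b = T a" unfolding ab(1) using T(1) ab(4) by (rule ratfun_endomorphism_divide)
  ultimately have "T z = T a / T b" by (simp add: nonzero_eq_divide_eq)
  then show ?thesis using A ab S by (simp add: scalar_subfield_def)
qed

text \<open>The map is the involution of \<open>swap_automorphism\<close> for the facets exchanged
  in either direction. The exchange right-hand sides contain only common facets, hence variables
  that it fixes.\<close>

lemma exchange_identification_exists:
  fixes p :: "'p::semifield seeds"
  assumes h: "h \<ge> 1" and man: "K \<in> triangulated_manifolds (2 * h)"
    and inv: "involution_choice h K \<sigma>" and L: "L \<in> bistellar_class h K"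
    and mv: "bistellar_move h L \<alpha> \<beta> L'"
  shows "\<exists>\<phi>. exchange_identification h \<sigma> p L \<alpha> \<beta> L' \<phi>"
proof -
  let ?s = "\<lambda>f. \<sigma> L \<alpha> ` f"
  let ?A = "exchanged_facets h \<alpha> \<beta>" and ?B = "exchanged_facets h \<beta> \<alpha>"
  let ?C = "common_facets h \<alpha> \<beta>"
  have dc: "down_closed (fst L)" by (rule down_closed_class [OF man L])
  have dc': "down_closed (fst L')" by (rule down_closed_move [OF mv dc])
  have bp: "bistellar_pair h (fst L) \<alpha> \<beta>"
    and L': "fst L' = (fst L - join_boundary \<alpha> \<beta>) \<union> join_boundary \<beta> \<alpha>"
    using mv by (auto simp: bistellar_move_def)
  note i = move_involution [OF inv L mv]
  have i': "\<forall>v\<in>\<beta> \<union> \<alpha>. \<sigma> L \<alpha> (\<sigma> L \<alpha> v) = v" using i(3) by blast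
  note rev = bistellar_pair_reverse [OF bp i(4) dc L']
  have sA: "?s t \<in> facets_join h \<beta> \<alpha>" "?s (?s t) = t" if "t \<in> facets_join h \<alpha> \<beta>" for t
    using that image_join_boundary [OF i(1-3), of t] by (auto simp: facets_join_def simplices_def)
  have sB: "?s t \<in> facets_join h \<alpha> \<beta>" "?s (?s t) = t" if "t \<in> facets_join h \<beta> \<alpha>" for t
    using that image_join_boundary [OF i(2,1) i', of t] by (auto simp: facets_join_def simplices_def)
  have AB: "?s f \<in> ?B" "?s (?s f) = f" if "f \<in> ?A" for f
    using that sA sB unfolding exchanged_facets_def by (metis DiffD1 DiffD2 DiffI)+
  have BA: "?s f \<in> ?A" "?s (?s f) = f" if "f \<in> ?B" for f
    using that sA sB unfolding exchanged_facets_def by (metis DiffD1 DiffD2 DiffI)+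
  have disj: "?A \<inter> ?B = {}" by (auto simp: exchanged_facets_def)
  have C: "?C = facets_join h \<alpha> \<beta> \<inter> facets_join h \<beta> \<alpha>"
    by (auto simp: common_facets_def exchanged_facets_def)
  have sC: "?s g \<in> ?C" if "g \<in> ?C" for g using that sA sB unfolding C by blast
  have CE: "g \<notin> ?A \<union> ?B" if "g \<in> ?C" for g using that unfolding C by (auto simp: exchanged_facets_def)
  have fin: "finite f" if "f \<in> facets_join h \<alpha> \<beta> \<union> facets_join h \<beta> \<alpha> \<union> facets h L \<union> facets h L'" for f
  proof -
    have "card f = 2 * h - 1 + 1" using that by (auto simp: facets_join_def facets_def simplices_def)
    then show ?thesis by (metis add_is_0 card.infinite one_neq_zero)
  qed
  have J: "facets_join h \<alpha> \<beta> \<subseteq> facets h L" "facets_join h \<beta> \<alpha> \<subseteq> facets h L'"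
    using join_boundary_in_complex [OF bp dc] join_boundary_in_complex [OF rev(1) dc']
    by (auto simp: facets_join_def facets_def simplices_def)
  \<comment> \<open>The second equation comes from the inverse pair, which restores
    \<open>fst L\<close>.\<close>
  have F: "facets h L' = (facets h L - facets_join h \<alpha> \<beta>) \<union> facets_join h \<beta> \<alpha>"
    "facets h L = (facets h L' - facets_join h \<beta> \<alpha>) \<union> facets_join h \<alpha> \<beta>"
    unfolding facets_def facets_join_def
    subgoal unfolding L' by (auto simp: simplices_def)
    subgoal by (subst rev(2)) (auto simp: simplices_def)
    done
  \<comment> \<open>By these equations a facet of both complexes that lies in one ball lies in the
    other as well, so it is not exchanged.\<close>
  have common: "f \<notin> ?A \<union> ?B" if "f \<in> facets h L" "f \<in> facets h L'" for f
  proof -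
    have "f \<notin> facets_join h \<alpha> \<beta> \<or> f \<in> facets_join h \<beta> \<alpha>" using that(2) unfolding F(1) by blast
    moreover have "f \<notin> facets_join h \<beta> \<alpha> \<or> f \<in> facets_join h \<alpha> \<beta>" using that(1) unfolding F(2) by blast
    ultimately show ?thesis by (auto simp: exchanged_facets_def)
  qed
  \<comment> \<open>Exchange relations are indexed by \<open>?A\<close>; on \<open>?B\<close> the
    value is transported by the involution, so that \<open>R\<close> is invariant under it.\<close>
  define R :: "face \<Rightarrow> 'p ratfun" where
    "R f = exchange_rhs h \<sigma> p L \<alpha> \<beta> (if f \<in> ?A then f else ?s f)" for f
  have RS: "exchange_rhs h \<sigma> p L \<alpha> \<beta> f \<in> S"
    if S: "scalar_subfield S" and v: "\<And>g. g \<in> ?C \<Longrightarrow> var g \<in> S" for S f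
    by (rule exchange_rhs_in_subfield [OF S]) (use v sC in blast)
  have "\<exists>T. ratfun_endomorphism T \<and> (\<forall>x. T (T x) = x) \<and>
      (\<forall>f\<in>?A \<union> ?B. T (var f) = R f / var (?s f)) \<and>
      (\<forall>f. finite f \<longrightarrow> f \<notin> ?A \<union> ?B \<longrightarrow> T (var f) = var f)"
  proof (rule swap_automorphism [of "?A \<union> ?B" ?s R])
    fix f assume f: "f \<in> ?A \<union> ?B"
    have "finite f" using f fin by (auto simp: exchanged_facets_def)
    moreover have "?s f \<in> ?A \<union> ?B" "?s (?s f) = f" using f AB [of f] BA [of f] by (elim UnE; simp)+
    ultimately show "finite f \<and> ?s f \<in> ?A \<union> ?B \<and> ?s (?s f) = f" by simp
    have "R (?s f) = R f"
    proof (cases "f \<in> ?A")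
      case True
      then show ?thesis using AB [OF True] disj by (auto simp: R_def)
    next
      case False
      then show ?thesis using BA [of f] f by (auto simp: R_def)
    qed
    then show "R f \<noteq> 0 \<and> R (?s f) = R f" by (simp add: R_def exchange_rhs_nonzero)
    fix S :: "'p ratfun set"
    assume S: "scalar_subfield S" "\<And>g. finite g \<Longrightarrow> g \<notin> ?A \<union> ?B \<Longrightarrow> var g \<in> S"
    show "R f \<in> S"
      unfolding R_def by (rule RS [OF S(1)]) (use S(2) CE fin C in blast)
  qed
  then obtain T where T: "ratfun_endomorphism T" "\<And>x. T (T x) = x"
    and TE: "\<And>f. f \<in> ?A \<union> ?B \<Longrightarrow> T (var f) = R f / var (?s f)"
    and TN: "\<And>f. finite f \<Longrightarrow> f \<notin> ?A \<union> ?B \<Longrightarrow> T (var f) = var f"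
    by blast
  have q: "x / y \<in> cluster_field h M" if "x \<in> cluster_field h M" "y \<in> cluster_field h M"
    for x y :: "'p ratfun" and M
    using that by (rule cluster_field_quotient)
  have RL: "R f \<in> cluster_field h M" if "?C \<subseteq> facets h M" for f M
    unfolding R_def
    by (rule RS [OF scalar_subfield_cluster_field]) (use that var_in_cluster_field in blast)
  have CL: "?C \<subseteq> facets h L" "?C \<subseteq> facets h L'" using J C by blast+
  have vL': "T (var f) \<in> cluster_field h L" if f: "f \<in> facets h L'" for f
  proof (cases "f \<in> facets h L")
    case True
    then show ?thesis using TN common f fin var_in_cluster_field by (metis UnCI)
  next
    case False
    then have fB: "f \<in> ?B" using f F J unfolding exchanged_facets_def by blast
    then have "?s f \<in> facets h L" using BA(1) J unfolding exchanged_facets_def by blast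
    then show ?thesis using fB TE RL [OF CL(1)] q var_in_cluster_field by (metis UnCI)
  qed
  have vL: "T (var f) \<in> cluster_field h L'" if f: "f \<in> facets h L" for f
  proof (cases "f \<in> facets h L'")
    case True
    then show ?thesis using TN common f fin var_in_cluster_field by (metis UnCI)
  next
    case False
    then have fA: "f \<in> ?A" using f F J unfolding exchanged_facets_def by blast
    then have "?s f \<in> facets h L'" using AB(1) J unfolding exchanged_facets_def by blast
    then show ?thesis using fA TE RL [OF CL(2)] q var_in_cluster_field by (metis UnCI)
  qed
  have m: "T z \<in> cluster_field h L" if "z \<in> cluster_field h L'" for z
    using ratfun_endomorphism_cluster_field [OF T scalar_subfield_cluster_field vL' that] .
  have m': "T z \<in> cluster_field h L'" if "z \<in> cluster_field h L" for z
    using ratfun_endomorphism_cluster_field [OF T scalar_subfield_cluster_field vL that] .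
  \<comment> \<open>Since \<open>T\<close> is its own inverse, the two inclusions suffice for
    bijectivity.\<close>
  have "bij_betw T (cluster_field h L') (cluster_field h L)"
    by (rule bij_betw_byWitness [of _ T]) (use T(2) m m' in auto)
  then have "algebra_isomorphism (cluster_field h L') (cluster_field h L) T"
    using T(1) unfolding algebra_isomorphism_def ratfun_endomorphism_def by blast
  moreover have "T (var f) = var f" if "f \<in> facets h L \<inter> facets h L'" for f
    using that common fin by (intro TN) auto
  moreover have "T (var (?s f)) = exchange_rhs h \<sigma> p L \<alpha> \<beta> f / var f" if f: "f \<in> ?A" for f
  proof -
    have "?s f \<notin> ?A" using AB(1) [OF f] disj by blast
    then show ?thesis using TE [of "?s f"] AB [OF f] by (simp add: R_def)
  qed
  ultimately show ?thesis unfolding exchange_identification_def using mv by blast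
qed

lemma identified_mem_cluster_field:
  assumes "identified h K \<sigma> p L z L' z'"
  shows "z \<in> cluster_field h L \<and> z' \<in> cluster_field h L'"
  using assms
proof induction
  case (step L \<alpha> \<beta> L' \<phi> z)
  then show ?case
    unfolding exchange_identification_def algebra_isomorphism_def bij_betw_def by blast
qed auto

section \<open>Isomorphisms between generated subalgebras\<close>

lemma subalgebra_generated_isomorphism:
  assumes iso: "algebra_isomorphism M N \<phi>" and sub: "subalgebra_generated scalar G \<subseteq> M"
  shows "algebra_isomorphism (subalgebra_generated scalar G) (subalgebra_generated scalar (\<phi> ` G)) \<phi>"
proof -
  let ?A = "subalgebra_generated scalar G" and ?B = "subalgebra_generated scalar (\<phi> ` G)"
  have hom: "\<phi> (x + y) = \<phi> x + \<phi> y" "\<phi> (x * y) = \<phi> x * \<phi> y" if "x \<in> ?A" "y \<in> ?A" for x y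
    using iso sub that unfolding algebra_isomorphism_def by blast+
  have sc: "\<phi> (scalar c) = scalar c" for c
    using iso unfolding algebra_isomorphism_def by blast
  have "\<phi> x \<in> ?B" if "x \<in> ?A" for x
    using that
  proof induction
    case (add x y)
    then show ?case by (simp add: hom subalgebra_generated.add)
  next
    case (mult x y)
    then show ?case by (simp add: hom subalgebra_generated.mult)
  qed (auto simp: sc intro: subalgebra_generated.intros)
  moreover have "w \<in> \<phi> ` ?A" if "w \<in> ?B" for w
    using that
  proof induction
    case (scalar c)
    then show ?case by (metis imageI sc subalgebra_generated.scalar)
  next
    case (gen w)
    then show ?case by (auto intro: subalgebra_generated.gen)
  next
    case (add x y)
    then obtain a b where "x = \<phi> a" "y = \<phi> b" "a \<in> ?A" "b \<in> ?A" by blast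
    then show ?case by (metis hom(1) imageI subalgebra_generated.add)
  next
    case (mult x y)
    then obtain a b where "x = \<phi> a" "y = \<phi> b" "a \<in> ?A" "b \<in> ?A" by blast
    then show ?case by (metis hom(2) imageI subalgebra_generated.mult)
  qed
  ultimately have "\<phi> ` ?A = ?B" by blast
  moreover have "inj_on \<phi> ?A"
    using iso sub unfolding algebra_isomorphism_def bij_betw_def by (blast intro: inj_on_subset)
  ultimately have "bij_betw \<phi> ?A ?B" by (simp add: bij_betw_def)
  then show ?thesis unfolding algebra_isomorphism_def using hom sc by blast
qed

lemma algebras_isomorphic_refl: "algebras_isomorphic A A"
  unfolding algebras_isomorphic_def algebra_isomorphism_def
  by (rule exI [of _ "\<lambda>x. x"]) (simp add: bij_betw_def)

lemma algebras_isomorphic_trans: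
  assumes "algebras_isomorphic A B" "algebras_isomorphic B C"
  shows "algebras_isomorphic A C"
proof -
  obtain \<phi> \<psi> where \<phi>: "algebra_isomorphism A B \<phi>" and \<psi>: "algebra_isomorphism B C \<psi>"
    using assms unfolding algebras_isomorphic_def by blast
  have mem: "\<phi> x \<in> B" if "x \<in> A" for x
    using \<phi> that unfolding algebra_isomorphism_def bij_betw_def by blast
  have "algebra_isomorphism A C (\<psi> \<circ> \<phi>)"
    using \<phi> \<psi> mem unfolding algebra_isomorphism_def by (auto intro: bij_betw_trans)
  then show ?thesis unfolding algebras_isomorphic_def by blast
qed

text \<open>The inverse respects sums, products and scalars because these lie in the domain of
  \<phi>, where \<phi> is injective; a generated subalgebra guarantees this.\<close>

lemma algebras_isomorphic_sym:
  assumes "algebras_isomorphic (subalgebra_generated scalar G) B"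
  shows "algebras_isomorphic B (subalgebra_generated scalar G)"
proof -
  let ?A = "subalgebra_generated scalar G"
  obtain \<phi> where \<phi>: "algebra_isomorphism ?A B \<phi>"
    using assms unfolding algebras_isomorphic_def by blast
  let ?\<psi> = "inv_into ?A \<phi>"
  have bij: "bij_betw \<phi> ?A B" using \<phi> by (simp add: algebra_isomorphism_def)
  have eqI: "?\<psi> y = x" if "x \<in> ?A" "\<phi> x = y" for x y
    using bij that by (metis bij_betw_inv_into_left)
  have mem: "?\<psi> y \<in> ?A" "\<phi> (?\<psi> y) = y" if "y \<in> B" for y
    using bij that by (auto simp: bij_betw_def inv_into_into f_inv_into_f)
  have "algebra_isomorphism B ?A ?\<psi>"
    unfolding algebra_isomorphism_def
  proof (intro conjI ballI allI bij_betw_inv_into [OF bij])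
    fix x y assume "x \<in> B" "y \<in> B"
    then show "?\<psi> (x + y) = ?\<psi> x + ?\<psi> y" "?\<psi> (x * y) = ?\<psi> x * ?\<psi> y"
      using \<phi> mem by (auto intro!: eqI subalgebra_generated.add subalgebra_generated.mult
        simp: algebra_isomorphism_def)
  next
    fix c show "?\<psi> (scalar c) = scalar c"
      using \<phi> by (auto intro!: eqI subalgebra_generated.scalar simp: algebra_isomorphism_def)
  qed
  then show ?thesis unfolding algebras_isomorphic_def by blast
qed

text \<open>The base complex enters the rules only through its class. This lets the algebras of two
  members of one class be compared within a single relation.\<close>

lemma identified_cong:
  assumes "identified h M \<sigma> p X z Y w" "bistellar_class h M = bistellar_class h N"
  shows "identified h N \<sigma> p X z Y w"
  using assms
proof induction
  case (step L \<alpha> \<beta> L' \<phi> z)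
  then show ?case using identified.step [of L h N \<sigma> p \<alpha> \<beta> L' \<phi> z] by simp
next
  case (sym L z L' z')
  then show ?case using identified.sym by simp
next
  case (trans L z L' z' L'' z'')
  then show ?case using identified.trans by metis
qed (simp add: identified.refl)

text \<open>The identification maps each element to one identified with it, so by transitivity it
  matches the generating sets and hence the algebras they generate.\<close>

lemma move_algebras_isomorphic:
  assumes h: "h \<ge> 1" and man: "K \<in> triangulated_manifolds (2 * h)"
    and inv: "involution_choice h K \<sigma>" and L: "L \<in> bistellar_class h K"
    and mv: "bistellar_move h L \<alpha> \<beta> L'"
  shows "algebras_isomorphic (bistellar_cluster_algebra h \<sigma> p L) (bistellar_cluster_algebra h \<sigma> p L')"
proof -
  have L': "L' \<in> bistellar_class h K" by (rule bistellar_class_move [OF L mv])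
  \<comment> \<open>\<open>G M\<close> collects all elements over \<open>M\<close> identified with a
    cluster variable of the class, with the relation based at \<open>K\<close> for every
    \<open>M\<close>.\<close>
  define G where "G M = {z. \<exists>N\<in>bistellar_class h K. \<exists>f\<in>facets h N. identified h K \<sigma> p M z N (var f)}" for M
  have A: "bistellar_cluster_algebra h \<sigma> p M = subalgebra_generated scalar (G M)" if "M \<in> bistellar_class h K" for M
  proof -
    have eq: "bistellar_class h M = bistellar_class h K" by (rule bistellar_class_eq [OF h man that])
    have "identified h M \<sigma> p M z N w \<longleftrightarrow> identified h K \<sigma> p M z N w" for z N w
      using identified_cong [OF _ eq] identified_cong [OF _ eq [symmetric]] by blast
    then show ?thesis unfolding bistellar_cluster_algebra_def G_def eq by simp
  qed
  obtain \<phi> where \<phi>: "exchange_identification h \<sigma> p L \<alpha> \<beta> L' \<phi>"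
    using exchange_identification_exists [OF h man inv L mv] by blast
  then have iso: "algebra_isomorphism (cluster_field h L') (cluster_field h L) \<phi>"
    by (simp add: exchange_identification_def)
  have step: "identified h K \<sigma> p L (\<phi> z) L' z" if "z \<in> cluster_field h L'" for z
    by (rule identified.step [OF L \<phi> that])
  have GL: "G M \<subseteq> cluster_field h M" for M
    unfolding G_def by (auto dest: identified_mem_cluster_field)
  \<comment> \<open>Membership in the generating sets is invariant under identification; this is
    used for both inclusions of \<open>img\<close>.\<close>
  have GI: "z \<in> G M" if "identified h K \<sigma> p M z M' z'" "z' \<in> G M'" for z z' M M'
    using that identified.trans [OF that(1)] unfolding G_def by blast
  have img: "\<phi> ` G L' = G L"
  proof (intro equalityI subsetI)
    fix w assume "w \<in> \<phi> ` G L'"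
    then obtain z where "z \<in> G L'" "w = \<phi> z" by blast
    moreover from this have "z \<in> cluster_field h L'" using GL by (metis subsetD)
    ultimately show "w \<in> G L" using GI [OF step] by simp
  next
    fix w assume w: "w \<in> G L"
    then have "w \<in> cluster_field h L" using GL by (metis subsetD)
    then have "w \<in> \<phi> ` cluster_field h L'"
      using iso by (simp add: algebra_isomorphism_def bij_betw_def)
    then obtain z where z: "z \<in> cluster_field h L'" "w = \<phi> z" by blast
    have "identified h K \<sigma> p L' z L w" unfolding z(2) by (rule identified.sym [OF step [OF z(1)]])
    then have "z \<in> G L'" using w by (rule GI)
    then show "w \<in> \<phi> ` G L'" using z by blast
  qed
  have sub: "subalgebra_generated scalar (G L') \<subseteq> cluster_field h L'"
  proof
    fix x assume "x \<in> subalgebra_generated scalar (G L')"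
    then show "x \<in> cluster_field h L'"
      by induction (use GL [of L'] in \<open>auto intro: scalar_in_cluster_field cluster_field_quotient\<close>)
  qed
  have "algebra_isomorphism (subalgebra_generated scalar (G L')) (subalgebra_generated scalar (G L)) \<phi>"
    using subalgebra_generated_isomorphism [OF iso sub] unfolding img .
  then have "algebras_isomorphic (subalgebra_generated scalar (G L')) (subalgebra_generated scalar (G L))"
    unfolding algebras_isomorphic_def by blast
  then show ?thesis unfolding A [OF L] A [OF L'] by (rule algebras_isomorphic_sym)
qed

theorem theorem5p21:
  fixes h :: nat
    and K K' :: oriented_complex
    and \<sigma> :: involutions
    and p :: "'p::semifield seeds"
  assumes "h \<ge> 1"
    and "K \<in> triangulated_manifolds (2 * h)"
    and "K' \<in> triangulated_manifolds (2 * h)"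
    and "K' \<in> bistellar_class h K"
    and "involution_choice h K \<sigma>"
    and "seed_family h K \<sigma> p"
  shows "algebras_isomorphic (bistellar_cluster_algebra h \<sigma> p K) (bistellar_cluster_algebra h \<sigma> p K')"
proof -
  have "(\<lambda>T T'. \<exists>\<alpha> \<beta>. bistellar_move h T \<alpha> \<beta> T')\<^sup>*\<^sup>* K K'"
    using assms(4) by (simp add: bistellar_class_def)
  then show ?thesis
  proof induction
    case base
    show ?case by (rule algebras_isomorphic_refl)
  next
    case (step T T')
    \<comment> \<open>The result for one move is stated relative to \<open>K\<close>, so the data
      given for \<open>K\<close> serve at every complex on the path.\<close>
    then have "T \<in> bistellar_class h K" by (simp add: bistellar_class_def)
    then show ?case
      using step move_algebras_isomorphic [OF assms(1,2,5)] algebras_isomorphic_trans by blast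
  qed
qed

end
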